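(* Let $n\ge 2$. The group $H_n=\pi_n(\mathcal{P}_n)$ is isomorphic to the group $\mathbf{E}_{n-1}^{-1}$.
   Context: $\mathcal{B}_n$ is Artin's braid group with generators $\sigma_1,\dots,\sigma_{n-1}$ and relations $\sigma_i\sigma_j=\sigma_j\sigma_i$ for $|i-j|\ge 2$ and $\sigma_i\sigma_{i+1}\sigma_i=\sigma_{i+1}\sigma_i\sigma_{i+1}$ for $1\le i\le n-2$. The pure braid group $\mathcal{P}_n$ is the kernel of the homomorphism $\mathcal{B}_n\to S_n$, $\sigma_i\mapsto (i,i+1)$. It is generated by all conjugates in $\mathcal{B}_n$ of the elements $\sigma_i^2$. Let $I_m$ be the $m\times m$ identity matrix and $$R=\frac{1}{\sqrt2}\begin{pmatrix}1&0&0&1\\0&1&-1&0\\0&1&1&0\\-1&0&0&1\end{pmatrix},$$ which satisfies the Yang-Baxter equation $(R\otimes I_2)(I_2\otimes R)(R\otimes I_2)=(I_2\otimes R)(R\otimes I_2)(I_2\otimes R)$. The representation $\pi_n$ of $\mathcal{B}_n$ on $(\mathbb{C}^2)^{\otimes n}$ is defined by $\pi_n(\sigma_i)=I_2^{\otimes (i-1)}\otimes R\otimes I_2^{\otimes (n-i-1)}$. Tensor products of matrices use the "left into right" convention: if $A=\begin{pmatrix}a&b\\c&d\end{pmatrix}$ then $X\otimes A=\begin{pmatrix}aX&bX\\ cX&dX\end{pmatrix}$. For $m\ge 1$ and $\nu=\pm1$, $\mathbf{E}_m^\nu$ is the abstract group generated by $x_1,\dots,x_m$ (together with the element $-1$)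 with relations $x_i^2=\nu$ for $1\le i\le m$, $x_ix_j=x_jx_i$ for $|i-j|\ge 2$, and $x_{i+1}x_i=-x_ix_{i+1}$ for $1\le i\le m-1$, where $-1$ is a central element of order two. *)

theory Defs
  imports "HOL-Algebra.Sym_Groups" "Jordan_Normal_Form.Matrix"
begin

section \<open>Groups given by generators and relations\<close>

datatype 'a letter = Pos 'a | Neg 'a

definition words :: "'a set \<Rightarrow> 'a letter list set" where
  "words X = lists (Pos ` X \<union> Neg ` X)"

inductive pres_eq :: "'a set \<Rightarrow> ('a letter list \<times> 'a letter list) set
    \<Rightarrow> 'a letter list \<Rightarrow> 'a letter list \<Rightarrow> bool"
  for X and Rel where
  pres_refl: "w \<in> words X \<Longrightarrow> pres_eq X Rel w w"
| pres_sym: "pres_eq X Rel u v \<Longrightarrow> pres_eq X Rel v u"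
| pres_trans: "pres_eq X Rel u v \<Longrightarrow> pres_eq X Rel v w \<Longrightarrow> pres_eq X Rel u w"
| pres_append: "pres_eq X Rel u v \<Longrightarrow> pres_eq X Rel u' v' \<Longrightarrow> pres_eq X Rel (u @ u') (v @ v')"
| pres_cancel1: "x \<in> X \<Longrightarrow> pres_eq X Rel [Pos x, Neg x] []"
| pres_cancel2: "x \<in> X \<Longrightarrow> pres_eq X Rel [Neg x, Pos x] []"
| pres_rel: "(u, v) \<in> Rel \<Longrightarrow> u \<in> words X \<Longrightarrow> v \<in> words X \<Longrightarrow> pres_eq X Rel u v"

definition pres_rel_set :: "'a set \<Rightarrow> ('a letter list \<times> 'a letter list) set
    \<Rightarrow> ('a letter list \<times> 'a letter list) set" where
  "pres_rel_set X Rel = {(u, v). pres_eq X Rel u v}"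

definition pres_class :: "'a set \<Rightarrow> ('a letter list \<times> 'a letter list) set
    \<Rightarrow> 'a letter list \<Rightarrow> 'a letter list set" where
  "pres_class X Rel w = pres_rel_set X Rel `` {w}"

text \<open>The group \<open>\<langle>X | u = v for (u, v) \<in> Rel\<rangle>\<close>.\<close>
definition presented_group :: "'a set \<Rightarrow> ('a letter list \<times> 'a letter list) set
    \<Rightarrow> 'a letter list set monoid" where
  "presented_group X Rel =
     \<lparr>carrier = words X // pres_rel_set X Rel,
      mult = (\<lambda>A B. \<Union>a\<in>A. \<Union>b\<in>B. pres_class X Rel (a @ b)),
      one = pres_class X Rel []\<rparr>"

fun letter_val :: "('g, 'b) monoid_scheme \<Rightarrow> ('a \<Rightarrow> 'g) \<Rightarrow> 'a letter \<Rightarrow> 'g" where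
  "letter_val G f (Pos x) = f x"
| "letter_val G f (Neg x) = inv\<^bsub>G\<^esub> (f x)"

fun word_val :: "('g, 'b) monoid_scheme \<Rightarrow> ('a \<Rightarrow> 'g) \<Rightarrow> 'a letter list \<Rightarrow> 'g" where
  "word_val G f [] = \<one>\<^bsub>G\<^esub>"
| "word_val G f (l # w) = letter_val G f l \<otimes>\<^bsub>G\<^esub> word_val G f w"

text \<open>The homomorphism out of a presented group determined by the values \<open>f\<close> on the
  generators. When \<open>f\<close> respects the relations, all words in a class have the
  same value; see \<open>presented_lift_hom\<close> and \<open>presented_lift_gen\<close> below.\<close>
definition presented_lift :: "('g, 'b) monoid_scheme \<Rightarrow> ('a \<Rightarrow> 'g) \<Rightarrow> 'a letter list set \<Rightarrow> 'g" where
  "presented_lift G f C = the_elem (word_val G f ` C)"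

lemma words_simps [simp]:
  "[] \<in> words X"
  "Pos x # w \<in> words X \<longleftrightarrow> x \<in> X \<and> w \<in> words X"
  "Neg x # w \<in> words X \<longleftrightarrow> x \<in> X \<and> w \<in> words X"
  "u @ v \<in> words X \<longleftrightarrow> u \<in> words X \<and> v \<in> words X"
  by (auto simp: words_def)

lemma pres_eq_words: "pres_eq X Rel u v \<Longrightarrow> u \<in> words X \<and> v \<in> words X"
  by (induction rule: pres_eq.induct) auto

lemma equiv_pres_rel_set: "equiv (words X) (pres_rel_set X Rel)"
  unfolding pres_rel_set_def
  by (rule equivI)
     (auto simp: refl_on_def sym_def trans_def
        intro: pres_refl pres_sym pres_trans dest: pres_eq_words)

lemma pres_class_iff: "v \<in> pres_class X Rel w \<longleftrightarrow> pres_eq X Rel w v"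
  by (simp add: pres_class_def pres_rel_set_def)

lemma pres_class_eq_iff:
  assumes "u \<in> words X" "v \<in> words X"
  shows "pres_class X Rel u = pres_class X Rel v \<longleftrightarrow> pres_eq X Rel u v"
  using eq_equiv_class_iff[OF equiv_pres_rel_set assms, of Rel]
  by (simp add: pres_class_def pres_rel_set_def)

lemma carrier_presented_group:
  "carrier (presented_group X Rel) = pres_class X Rel ` words X"
  by (auto simp: presented_group_def pres_class_def quotient_def)

lemma one_presented_group: "\<one>\<^bsub>presented_group X Rel\<^esub> = pres_class X Rel []"
  by (simp add: presented_group_def)

lemma mult_presented_group:
  assumes "u \<in> words X" "v \<in> words X"
  shows "pres_class X Rel u \<otimes>\<^bsub>presented_group X Rel\<^esub> pres_class X Rel v = pres_class X Rel (u @ v)"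
proof -
  have "pres_class X Rel (a @ b) = pres_class X Rel (u @ v)"
    if "a \<in> pres_class X Rel u" "b \<in> pres_class X Rel v" for a b
    using that assms
    by (metis pres_append pres_class_eq_iff pres_class_iff pres_eq_words)
  moreover have "u \<in> pres_class X Rel u" "v \<in> pres_class X Rel v"
    using assms by (auto simp: pres_class_iff intro: pres_refl)
  ultimately show ?thesis
    unfolding presented_group_def monoid.simps by blast
qed

lemma word_inverse:
  "w \<in> words X \<Longrightarrow> \<exists>v\<in>words X. pres_eq X Rel (v @ w) []"
proof (induction w)
  case Nil
  then show ?case by (intro bexI[of _ "[]"]) (auto intro: pres_refl)
next
  case (Cons l w)
  then have "w \<in> words X" by (cases l) auto
  with Cons obtain v where v: "v \<in> words X" "pres_eq X Rel (v @ w) []" by auto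
  obtain k where k: "[k] \<in> words X" "pres_eq X Rel [k, l] []"
    using Cons.prems by (cases l) (auto intro: pres_cancel1 pres_cancel2 simp: words_def)
  have "pres_eq X Rel ((v @ [k, l]) @ w) ((v @ []) @ w)"
    using v k \<open>w \<in> words X\<close> by (intro pres_append pres_refl) auto
  then have "pres_eq X Rel ((v @ [k]) @ l # w) []"
    using v by (auto intro: pres_trans)
  then show ?case using v k by (intro bexI[of _ "v @ [k]"]) auto
qed

lemma group_presented_group: "group (presented_group X Rel)"
proof (rule groupI)
  fix A assume "A \<in> carrier (presented_group X Rel)"
  then obtain w where w: "A = pres_class X Rel w" "w \<in> words X"
    by (auto simp: carrier_presented_group)
  obtain v where "v \<in> words X" "pres_eq X Rel (v @ w) []" using word_inverse[OF w(2)] by blast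
  with w show "\<exists>B\<in>carrier (presented_group X Rel). B \<otimes>\<^bsub>presented_group X Rel\<^esub> A = \<one>\<^bsub>presented_group X Rel\<^esub>"
    by (intro bexI[of _ "pres_class X Rel v"])
       (auto simp: carrier_presented_group mult_presented_group one_presented_group pres_class_eq_iff)
qed (auto simp: carrier_presented_group mult_presented_group one_presented_group)

locale presented_lift_locale = group G for G (structure) +
  fixes X :: "'x set" and Rel and f :: "'x \<Rightarrow> 'a"
  assumes gen_closed: "x \<in> X \<Longrightarrow> f x \<in> carrier G"
  assumes rel_val: "(u, v) \<in> Rel \<Longrightarrow> u \<in> words X \<Longrightarrow> v \<in> words X \<Longrightarrow> word_val G f u = word_val G f v"
begin

lemma word_val_closed: "w \<in> words X \<Longrightarrow> word_val G f w \<in> carrier G"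
proof (induction w)
  case (Cons l w) then show ?case by (cases l) (auto simp: gen_closed)
qed auto

lemma word_val_append:
  "u \<in> words X \<Longrightarrow> v \<in> words X \<Longrightarrow> word_val G f (u @ v) = word_val G f u \<otimes> word_val G f v"
proof (induction u)
  case (Cons l u) then show ?case
    by (cases l) (auto simp: gen_closed word_val_closed m_assoc)
qed (auto simp: word_val_closed)

lemma word_val_pres_eq: "pres_eq X Rel u v \<Longrightarrow> word_val G f u = word_val G f v"
proof (induction rule: pres_eq.induct)
  case (pres_append u v u' v')
  then show ?case
    using pres_eq_words[OF pres_append.hyps(1)] pres_eq_words[OF pres_append.hyps(2)]
    by (simp add: word_val_append)
qed (simp_all add: gen_closed rel_val)

lemma presented_lift_class:
  assumes "w \<in> words X"
  shows "presented_lift G f (pres_class X Rel w) = word_val G f w"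
proof -
  have "word_val G f ` pres_class X Rel w = {word_val G f w}"
    using assms word_val_pres_eq by (auto simp: pres_class_iff image_iff intro!: exI pres_refl)
  then show ?thesis by (simp add: presented_lift_def)
qed

lemma presented_lift_hom: "presented_lift G f \<in> hom (presented_group X Rel) G"
  by (auto simp: hom_def carrier_presented_group mult_presented_group presented_lift_class
        word_val_closed word_val_append)

lemma presented_lift_gen: "x \<in> X \<Longrightarrow> presented_lift G f (pres_class X Rel [Pos x]) = f x"
  by (simp add: presented_lift_class gen_closed)

end

section \<open>Braid groups and pure braid groups\<close>

definition braid_rels :: "nat \<Rightarrow> (nat letter list \<times> nat letter list) set" where
  "braid_rels n =
     {([Pos i, Pos j], [Pos j, Pos i]) | i j.
        i \<in> {1..n-1} \<and> j \<in> {1..n-1} \<and> \<bar>int i - int j\<bar> \<ge> 2}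
   \<union> {([Pos i, Pos (i+1), Pos i], [Pos (i+1), Pos i, Pos (i+1)]) | i. i \<in> {1..n-2}}"

definition braid_group :: "nat \<Rightarrow> nat letter list set monoid" where
  "braid_group n = presented_group {1..n-1} (braid_rels n)"

definition braid_perm :: "nat \<Rightarrow> nat letter list set \<Rightarrow> nat \<Rightarrow> nat" where
  "braid_perm n = presented_lift (sym_group n) (\<lambda>i. transpose i (i+1))"

definition pure_braid :: "nat \<Rightarrow> nat letter list set set" where
  "pure_braid n = kernel (braid_group n) (sym_group n) (braid_perm n)"

section \<open>The representation\<close>

text \<open>The ``left into right'' tensor product: the \<open>(p, q)\<close> block of \<open>tensor_mat X A\<close> is
  \<open>A $$ (p, q)\<close> times \<open>X\<close>, so the index of \<open>A\<close> is the high-order part.\<close>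
definition tensor_mat :: "complex mat \<Rightarrow> complex mat \<Rightarrow> complex mat" where
  "tensor_mat X A = mat (dim_row X * dim_row A) (dim_col X * dim_col A)
     (\<lambda>(i, j). A $$ (i div dim_row X, j div dim_col X) * X $$ (i mod dim_row X, j mod dim_col X))"

fun tensor_power :: "complex mat \<Rightarrow> nat \<Rightarrow> complex mat" where
  "tensor_power X 0 = 1\<^sub>m 1"
| "tensor_power X (Suc k) = tensor_mat (tensor_power X k) X"

definition R_mat :: "complex mat" where
  "R_mat = complex_of_real (1 / sqrt 2) \<cdot>\<^sub>m mat_of_rows_list 4
     [[ 1, 0,  0, 1],
      [ 0, 1, -1, 0],
      [ 0, 1,  1, 0],
      [-1, 0,  0, 1]]"

definition braid_rep_gen :: "nat \<Rightarrow> nat \<Rightarrow> complex mat" where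
  "braid_rep_gen n i =
     tensor_mat (tensor_mat (tensor_power (1\<^sub>m 2) (i-1)) R_mat) (tensor_power (1\<^sub>m 2) (n-i-1))"

definition GL_mat :: "nat \<Rightarrow> complex mat monoid" where
  "GL_mat d = units_of (ring_mat TYPE(complex) d ())"

definition braid_rep :: "nat \<Rightarrow> nat letter list set \<Rightarrow> complex mat" where
  "braid_rep n = presented_lift (GL_mat (2 ^ n)) (braid_rep_gen n)"

definition H_group :: "nat \<Rightarrow> complex mat monoid" where
  "H_group n = (GL_mat (2 ^ n)) \<lparr>carrier := braid_rep n ` pure_braid n\<rparr>"

section \<open>The groups \<open>E_m^\<nu>\<close>\<close>

datatype E_gen = MinusOne | Xgen nat

text \<open>The word expressing the sign \<open>\<nu>\<close>, which is only meaningful for \<open>\<nu> = 1\<close> and \<open>\<nu> = -1\<close>.\<close>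
definition sign_word :: "int \<Rightarrow> E_gen letter list" where
  "sign_word \<nu> = (if \<nu> = 1 then [] else [Pos MinusOne])"

definition E_rels :: "nat \<Rightarrow> int \<Rightarrow> (E_gen letter list \<times> E_gen letter list) set" where
  "E_rels m \<nu> =
     {([Pos MinusOne, Pos MinusOne], [])}
   \<union> {([Pos MinusOne, Pos (Xgen i)], [Pos (Xgen i), Pos MinusOne]) | i. i \<in> {1..m}}
   \<union> {([Pos (Xgen i), Pos (Xgen i)], sign_word \<nu>) | i. i \<in> {1..m}}
   \<union> {([Pos (Xgen i), Pos (Xgen j)], [Pos (Xgen j), Pos (Xgen i)]) | i j.
        i \<in> {1..m} \<and> j \<in> {1..m} \<and> \<bar>int i - int j\<bar> \<ge> 2}
   \<union> {([Pos (Xgen (i+1)), Pos (Xgen i)], [Pos MinusOne, Pos (Xgen i), Pos (Xgen (i+1))]) | i.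
        i \<in> {1..m-1}}"

definition E_group :: "nat \<Rightarrow> int \<Rightarrow> E_gen letter list set monoid" where
  "E_group m \<nu> = presented_group (insert MinusOne (Xgen ` {1..m})) (E_rels m \<nu>)"

end

theory Submission
  imports Defs
begin

text \<open>
  Write \<open>R = (1 + S) / sqrt 2\<close>. Then \<open>S\<^sup>2 = -1\<close> and \<open>R\<^sup>2 = S\<close>, and the translates \<open>S_i = \<pi>(\<sigma>_i\<^sup>2)\<close> of
  \<open>S\<close> satisfy the defining relations of \<open>E_{n-1}^{-1}\<close>. Conjugating \<open>S_i\<close> by \<open>\<pi>(\<sigma>_j)\<close> gives \<open>S_i\<close> or
  \<open>S_j S_i\<close>, so the group \<open>K\<close> generated by \<open>-1\<close> and the \<open>S_i\<close> is normalized by \<open>\<pi>(B_n)\<close>. As the pure braid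
  group is the normal closure of the \<open>\<sigma>_i\<^sup>2\<close> (this is the Coxeter presentation of the symmetric group),
  \<open>\<pi>(P_n) = K\<close>. Finally \<open>E_{n-1}^{-1} \<rightarrow> K\<close> is injective: in a normal form \<open>w x_p\<close>, with \<open>w\<close> a word in \<open>-1\<close> and
  \<open>x_1, \<dots>, x_{p-1}\<close>, the image of \<open>w\<close> commutes with the diagonal sign matrix of the tensor factor \<open>p + 1\<close>,
  while that of \<open>x_p\<close> anticommutes with it, so the product is not \<open>1\<close>.
\<close>

section \<open>Groups generated by Coxeter generators\<close>

text \<open>Induction on \<open>g\<close> with \<open>d\<close> arbitrary absorbs a product one
  factor at a time. \<open>D\<close> need not be a subgroup: once it contains \<open>\<one>\<close>,
  a set of normal forms is seen to exhaust the generated group.\<close>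

lemma generate_mult_closed:
  assumes "group G" and "g \<in> generate G T"
    and "\<And>d t. \<lbrakk>d \<in> D; t \<in> T\<rbrakk> \<Longrightarrow> d \<otimes>\<^bsub>G\<^esub> t \<in> D"
    and "\<And>d t. \<lbrakk>d \<in> D; t \<in> T\<rbrakk> \<Longrightarrow> d \<otimes>\<^bsub>G\<^esub> inv\<^bsub>G\<^esub> t \<in> D"
    and "D \<subseteq> carrier G" "T \<subseteq> carrier G" "d \<in> D"
  shows "d \<otimes>\<^bsub>G\<^esub> g \<in> D"
proof -
  interpret group G by fact
  from assms(2,7) show ?thesis
  proof (induction g arbitrary: d rule: generate.induct)
    case one
    then show ?case using assms(5) by auto
  next
    case (eng h1 h2)
    then have "h1 \<in> carrier G" "h2 \<in> carrier G" "d \<in> carrier G"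
      using assms(5,6) generate_in_carrier by blast+
    then show ?case using eng by (simp add: m_assoc[symmetric])
  qed (use assms in auto)
qed

lemma presented_group_generated:
  "carrier (presented_group X Rel)
     = generate (presented_group X Rel) ((\<lambda>x. pres_class X Rel [Pos x]) ` X)"
    (is "carrier ?P = generate ?P ?T")
proof -
  interpret group ?P by (rule group_presented_group)
  have T: "?T \<subseteq> carrier ?P" by (auto simp: carrier_presented_group)
  have inv: "pres_class X Rel [Neg x] = inv\<^bsub>?P\<^esub> pres_class X Rel [Pos x]" if "x \<in> X" for x
    using that
    by (intro inv_equality[symmetric])
       (auto simp: carrier_presented_group mult_presented_group one_presented_group
          pres_class_eq_iff intro: pres_cancel2)
  have "pres_class X Rel w \<in> generate ?P ?T" if "w \<in> words X" for w
    using that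
  proof (induction w)
    case Nil
    then show ?case using generate.one[of ?P ?T] by (simp add: one_presented_group)
  next
    case (Cons l w)
    then have l: "[l] \<in> words X" and w: "w \<in> words X" by (cases l; simp)+
    have "pres_class X Rel [l] \<in> generate ?P ?T"
      using l by (cases l) (auto simp: inv intro: generate.incl generate.inv)
    then have "pres_class X Rel [l] \<otimes>\<^bsub>?P\<^esub> pres_class X Rel w \<in> generate ?P ?T"
      using Cons.IH w by (intro generate.eng)
    then show ?case using l w by (simp add: mult_presented_group)
  qed
  then show ?thesis
    using generate_incl[OF T] by (auto simp: carrier_presented_group)
qed

lemma (in group_hom) hom_image_generated:
  assumes "carrier G = generate G T" "T \<subseteq> carrier G"
  shows "h ` carrier G = generate H (h ` T)"
  using assms generate_img by simp

text \<open>Of the \<open>f i\<close> only the Coxeter relations and their images under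
  \<open>h\<close> are assumed. The goal is injectivity of \<open>h\<close> on the subgroup they
  generate, which amounts to the Coxeter presentation of the symmetric group.\<close>

locale coxeter_generators = group_hom G "sym_group n" h for G (structure) and n h +
  fixes f :: "nat \<Rightarrow> 'a" and m :: nat
  assumes f_closed: "i \<in> {1..m} \<Longrightarrow> f i \<in> carrier G"
    and f_sq: "i \<in> {1..m} \<Longrightarrow> f i \<otimes> f i = \<one>"
    and f_far: "\<lbrakk>i \<in> {1..m}; j \<in> {1..m}; i + 2 \<le> j\<rbrakk> \<Longrightarrow> f i \<otimes> f j = f j \<otimes> f i"
    and f_braid: "\<lbrakk>i \<in> {1..m}; i + 1 \<in> {1..m}\<rbrakk> \<Longrightarrow>
      f i \<otimes> (f (i + 1) \<otimes> f i) = f (i + 1) \<otimes> (f i \<otimes> f (i + 1))"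
    and h_f: "i \<in> {1..m} \<Longrightarrow> h (f i) = transpose i (i + 1)"
begin

text \<open>The chain of standard parabolic subgroups, starting with the trivial group at
  \<open>k = 0\<close>; injectivity is proved by induction along it.\<close>

definition W :: "nat \<Rightarrow> 'a set" where
  "W k = generate G (f ` {1..k})"

text \<open>The minimal coset representative \<open>f p \<otimes> f (p - 1) \<otimes> \<dots> \<otimes> f k\<close> of \<open>W (p - 1)\<close>,
  with \<open>k = p + 1\<close> for the trivial coset.\<close>
definition desc :: "nat \<Rightarrow> nat \<Rightarrow> 'a" where
  "desc p k = foldr (\<lambda>i g. g \<otimes> f i) [k..<Suc p] \<one>"

lemma desc_end [simp]: "desc p (Suc p) = \<one>"
  by (simp add: desc_def)

lemma desc_step: "k \<le> p \<Longrightarrow> desc p k = desc p (Suc k) \<otimes> f k"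
  by (simp add: desc_def upt_conv_Cons del: upt_Suc)

lemma f_inv: "i \<in> {1..m} \<Longrightarrow> inv (f i) = f i"
  using f_sq f_closed G.inv_equality by blast

lemma desc_closed: "\<lbrakk>1 \<le> k; p \<le> m; k \<le> Suc p\<rbrakk> \<Longrightarrow> desc p k \<in> carrier G"
  by (rotate_tac 2, induction k rule: inc_induct) (auto simp: desc_step f_closed)

text \<open>Every factor \<open>f i\<close> of \<open>desc p k\<close> has
  \<open>i \<ge> j + 2\<close>, so far commutation alone carries \<open>f j\<close> across.\<close>

lemma desc_comm_low:
  assumes "1 \<le> j" "p \<le> m" "k \<le> Suc p" "j + 2 \<le> k"
  shows "desc p k \<otimes> f j = f j \<otimes> desc p k"
  using assms(3,4)
proof (induction k rule: inc_induct)
  case base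
  then show ?case using assms f_closed[of j] by simp
next
  case (step k)
  then have *: "desc p (Suc k) \<in> carrier G" "f k \<in> carrier G" "f j \<in> carrier G"
    using assms by (auto intro!: desc_closed f_closed)
  have "desc p k \<otimes> f j = desc p (Suc k) \<otimes> (f k \<otimes> f j)"
    using step * by (simp add: desc_step G.m_assoc)
  also have "f k \<otimes> f j = f j \<otimes> f k"
    using f_far[of j k] step assms by auto
  also have "desc p (Suc k) \<otimes> (f j \<otimes> f k) = (desc p (Suc k) \<otimes> f j) \<otimes> f k"
    using * by (simp add: G.m_assoc)
  also have "\<dots> = f j \<otimes> desc p k"
    using step * by (simp add: desc_step G.m_assoc)
  finally show ?case .
qed

text \<open>Moving left, \<open>f (Suc j)\<close> first commutes with the factors of index below
  \<open>j\<close>. One braid relation at \<open>f (Suc j) f j\<close> then turns it into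
  \<open>f j\<close>, which commutes with the remaining factors of index at least
  \<open>j + 2\<close>. The base case is the braid move, the induction step the commutation before
  it.\<close>

lemma desc_comm_high:
  assumes "1 \<le> k" "p \<le> m" "k \<le> j" "j < p"
  shows "desc p k \<otimes> f (Suc j) = f j \<otimes> desc p k"
  using assms(3,1)
proof (induction k rule: inc_induct)
  case base
  let ?c = "desc p (Suc (Suc j))" and ?a = "f j" and ?b = "f (Suc j)"
  have c: "?c \<in> carrier G" "?a \<in> carrier G" "?b \<in> carrier G"
    using assms by (auto intro!: desc_closed f_closed)
  have d: "desc p j = ?c \<otimes> ?b \<otimes> ?a"
    using assms by (simp add: desc_step)
  have "desc p j \<otimes> ?b = ?c \<otimes> (?b \<otimes> (?a \<otimes> ?b))"
    using c by (simp add: d G.m_assoc)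
  also have "?b \<otimes> (?a \<otimes> ?b) = ?a \<otimes> (?b \<otimes> ?a)"
    using f_braid[of j] assms by simp
  also have "?c \<otimes> (?a \<otimes> (?b \<otimes> ?a)) = (?c \<otimes> ?a) \<otimes> (?b \<otimes> ?a)"
    using c by (simp add: G.m_assoc)
  also have "?c \<otimes> ?a = ?a \<otimes> ?c"
    using assms by (intro desc_comm_low) auto
  finally show ?case using c by (simp add: d G.m_assoc)
next
  case (step k)
  then have *: "desc p (Suc k) \<in> carrier G" "f k \<in> carrier G" "f j \<in> carrier G"
      "f (Suc j) \<in> carrier G"
    using assms by (auto intro!: desc_closed f_closed)
  have "desc p k \<otimes> f (Suc j) = desc p (Suc k) \<otimes> (f k \<otimes> f (Suc j))"
    using step * assms by (simp add: desc_step G.m_assoc)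
  also have "f k \<otimes> f (Suc j) = f (Suc j) \<otimes> f k"
    using f_far[of k "Suc j"] step assms by auto
  also have "desc p (Suc k) \<otimes> (f (Suc j) \<otimes> f k) = (desc p (Suc k) \<otimes> f (Suc j)) \<otimes> f k"
    using * by (simp add: G.m_assoc)
  also have "\<dots> = f j \<otimes> desc p k"
    using step * assms by (simp add: desc_step G.m_assoc)
  finally show ?case .
qed

section \<open>Normal forms in the parabolic subgroups and injectivity\<close>

lemma W_closed: "\<lbrakk>w \<in> W p; p \<le> m\<rbrakk> \<Longrightarrow> w \<in> carrier G"
  unfolding W_def using f_closed by (intro G.generate_in_carrier[of "f ` {1..p}"]) auto

text \<open>The set of all products \<open>w \<otimes> desc p k\<close> contains
  \<open>\<one>\<close> and is stable under right multiplication by each generator of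
  \<open>W p\<close>, hence is all of \<open>W p\<close>.\<close>

lemma W_normal_form:
  assumes "p \<le> m" "1 \<le> p" "g \<in> W p"
  obtains w k where "w \<in> W (p - 1)" "1 \<le> k" "k \<le> Suc p" "g = w \<otimes> desc p k"
proof -
  define D where "D = {w \<otimes> desc p k | w k. w \<in> W (p - 1) \<and> 1 \<le> k \<and> k \<le> Suc p}"
  have D: "D \<subseteq> carrier G"
    using assms W_closed[of _ "p - 1"] by (auto simp: D_def intro!: desc_closed)
  have f_in_W: "f i \<in> W (p - 1)" if "1 \<le> i" "i < p" for i
    unfolding W_def using that by (intro generate.incl) auto
  have W_mult: "w \<otimes> v \<in> W (p - 1)" if "w \<in> W (p - 1)" "v \<in> W (p - 1)" for w v
    using that by (simp add: W_def generate.eng)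
  have step: "d \<otimes> f j \<in> D" if d: "d \<in> D" and j: "j \<in> {1..p}" for d j
  proof -
    obtain w k where d: "d = w \<otimes> desc p k" "w \<in> W (p - 1)" "1 \<le> k" "k \<le> Suc p"
      using d by (auto simp: D_def)
    have c: "w \<in> carrier G" "desc p k \<in> carrier G" "f j \<in> carrier G"
      using assms d j W_closed[of w "p - 1"] by (auto intro!: desc_closed f_closed)
    \<comment> \<open>Covers the cases where \<open>f j\<close> crosses \<open>desc p k\<close> and
      emerges as a generator of \<open>W (p - 1)\<close>, to be absorbed into
      \<open>w\<close>.\<close>
    have shift: ?thesis if "desc p k \<otimes> f j = f i \<otimes> desc p k" "1 \<le> i" "i < p" for i
    proof -
      have "f i \<in> carrier G" using that assms by (auto intro: f_closed)
      then have "d \<otimes> f j = (w \<otimes> f i) \<otimes> desc p k"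
        using that c d by (simp add: G.m_assoc)
      then show ?thesis using W_mult[OF d(2) f_in_W[OF that(2,3)]] d unfolding D_def by blast
    qed
    \<comment> \<open>In this order: \<open>f j\<close> crosses unchanged; it lengthens the
      descending product to \<open>desc p j\<close>; it cancels the last factor; it crosses and
      becomes \<open>f (j - 1)\<close>.\<close>
    consider "j + 2 \<le> k" | "j + 1 = k" | "j = k" | "k < j" by linarith
    then show ?thesis
    proof cases
      case 1
      then show ?thesis
        using desc_comm_low[of j p k] shift[of j] assms d j by auto
    next
      case 2
      then have "d \<otimes> f j = w \<otimes> desc p j"
        using d j c by (auto simp: desc_step G.m_assoc)
      moreover have "1 \<le> j" "j \<le> Suc p" using j by auto
      ultimately show ?thesis using d unfolding D_def by blast
    next
      case 3
      have e: "desc p (Suc k) \<in> carrier G"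
        using d 3 j assms by (auto intro!: desc_closed)
      have "desc p k \<otimes> f j = desc p (Suc k) \<otimes> (f j \<otimes> f j)"
        using 3 d j c e by (simp add: desc_step G.m_assoc)
      also have "\<dots> = desc p (Suc k)"
        using f_sq[of j] j assms e by auto
      finally have "d \<otimes> f j = w \<otimes> desc p (Suc k)"
        using d c by (simp add: G.m_assoc)
      then show ?thesis using d j 3 by (fastforce simp: D_def)
    next
      case 4
      then show ?thesis
        using shift[of "j - 1"] assms d j
        desc_comm_high[of k p "j - 1"] by auto
    qed
  qed
  have "\<one> \<otimes> desc p (Suc p) \<in> D"
    unfolding D_def W_def using generate.one by fastforce
  then have one: "\<one> \<in> D" by simp
  have "\<one> \<otimes> g \<in> D"
  proof (rule generate_mult_closed[OF G.is_group _ _ _ D _ one])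
    show "g \<in> generate G (f ` {1..p})" using assms by (simp add: W_def)
  qed (use assms step f_closed f_inv in auto)
  moreover have "g \<in> carrier G" using assms W_closed by blast
  ultimately show ?thesis using that by (auto simp: D_def)
qed

text \<open>The generators of \<open>W p\<close> map to transpositions of points that are at most
  \<open>p + 1\<close>.\<close>

lemma h_W_fixes:
  assumes "w \<in> W p" "p \<le> m" "x > Suc p"
  shows "h w x = x"
proof -
  \<comment> \<open>Carrier membership is carried through the induction so that \<open>h\<close> can
    be multiplied out.\<close>
  have "\<forall>y. w \<in> carrier G \<and> h w x = x" using assms(1) unfolding W_def
  proof (induction rule: generate.induct)
    case one
    then show ?case by (simp add: sym_group_def)
  next
    case (incl g)
    then show ?case using assms f_closed by (auto simp: h_f)
  next
    case (inv g)
    then show ?case using assms f_closed by (auto simp: h_f f_inv)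
  next
    case (eng g1 g2)
    then show ?case by (simp add: sym_group_def)
  qed
  then show ?thesis by simp
qed

text \<open>The rightmost factor acts first, so the factors \<open>f k\<close>,
  \<open>f (k + 1)\<close>, ..., \<open>f p\<close> push the point \<open>k\<close> up one place
  each.\<close>

lemma h_desc:
  assumes "1 \<le> k" "k \<le> Suc p" "p \<le> m"
  shows "h (desc p k) k = Suc p"
  using assms(2,1)
proof (induction k rule: inc_induct)
  case base
  then show ?case by (simp add: sym_group_def)
next
  case (step k)
  then have "desc p (Suc k) \<in> carrier G" "f k \<in> carrier G"
    using assms by (auto intro!: desc_closed f_closed)
  then show ?case
    using step assms by (simp add: desc_step h_f sym_group_def)
qed

text \<open>For \<open>g = w \<otimes> desc (Suc p) k\<close> the image of \<open>g\<close> takes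
  \<open>k\<close> to \<open>p + 2\<close>, a point fixed by \<open>w\<close>. If it is the identity
  then \<open>k = p + 2\<close>, so the coset is trivial and \<open>g\<close> already lies in
  \<open>W p\<close>.\<close>

lemma h_injective:
  assumes "g \<in> W p" "p \<le> m" "h g = id"
  shows "g = \<one>"
  using assms
proof (induction p arbitrary: g)
  case 0
  then show ?case by (simp add: W_def G.generate_empty)
next
  case (Suc p)
  obtain w k where g: "w \<in> W p" "1 \<le> k" "k \<le> Suc (Suc p)" "g = w \<otimes> desc (Suc p) k"
    by (rule W_normal_form[of "Suc p" g]) (use Suc.prems in simp_all)
  have c: "w \<in> carrier G" "desc (Suc p) k \<in> carrier G"
    using g Suc.prems W_closed[of w p] by (auto intro: desc_closed)
  have "h g k = h w (Suc (Suc p))"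
    using g c Suc.prems by (simp add: h_desc sym_group_def)
  also have "\<dots> = Suc (Suc p)"
    using g Suc.prems h_W_fixes[of w p "Suc (Suc p)"] by simp
  finally have "k = Suc (Suc p)" using Suc.prems by simp
  then have "g = w" using g c by simp
  then show ?case using Suc.IH[of w] Suc.prems g by simp
qed

end

section \<open>The pure braid group as a normal closure\<close>

definition braid_gen :: "nat \<Rightarrow> nat \<Rightarrow> nat letter list set" where
  "braid_gen n i = pres_class {1..n-1} (braid_rels n) [Pos i]"

lemma group_braid_group: "group (braid_group n)"
  by (simp add: braid_group_def group_presented_group)

lemma braid_gen_closed: "i \<in> {1..n-1} \<Longrightarrow> braid_gen n i \<in> carrier (braid_group n)"
  by (auto simp: braid_gen_def braid_group_def carrier_presented_group)

lemma braid_group_generated: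
  "carrier (braid_group n) = generate (braid_group n) (braid_gen n ` {1..n-1})"
  using presented_group_generated[of "{1..n-1}" "braid_rels n"]
  by (simp add: braid_group_def braid_gen_def)

lemma braid_gen_far:
  assumes "i \<in> {1..n-1}" "j \<in> {1..n-1}" "i + 2 \<le> j"
  shows "braid_gen n i \<otimes>\<^bsub>braid_group n\<^esub> braid_gen n j
    = braid_gen n j \<otimes>\<^bsub>braid_group n\<^esub> braid_gen n i"
proof -
  have "([Pos i, Pos j], [Pos j, Pos i]) \<in> braid_rels n"
    using assms unfolding braid_rels_def by fastforce
  then show ?thesis
    using assms
    by (auto simp: braid_gen_def braid_group_def mult_presented_group pres_class_eq_iff
        intro: pres_rel)
qed

lemma braid_gen_braid:
  assumes "i \<in> {1..n-1}" "i + 1 \<in> {1..n-1}"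
  shows "braid_gen n i \<otimes>\<^bsub>braid_group n\<^esub> (braid_gen n (i + 1) \<otimes>\<^bsub>braid_group n\<^esub> braid_gen n i)
    = braid_gen n (i + 1) \<otimes>\<^bsub>braid_group n\<^esub> (braid_gen n i \<otimes>\<^bsub>braid_group n\<^esub> braid_gen n (i + 1))"
proof -
  have "([Pos i, Pos (i+1), Pos i], [Pos (i+1), Pos i, Pos (i+1)]) \<in> braid_rels n"
    using assms unfolding braid_rels_def by fastforce
  then show ?thesis
    using assms
    by (auto simp: braid_gen_def braid_group_def mult_presented_group pres_class_eq_iff
        intro: pres_rel)
qed

lemma transpose_presented_lift:
  "presented_lift_locale (sym_group n) {1..n-1} (braid_rels n) (\<lambda>i. transpose i (i + 1))"
proof -
  interpret group "sym_group n" by (rule sym_group_is_group)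
  show ?thesis
  proof
    fix i assume "i \<in> {1..n-1}"
    then show "transpose i (i + 1) \<in> carrier (sym_group n)"
      by (auto simp: sym_group_carrier intro!: permutes_swap_id)
  next
    fix u v assume "(u, v) \<in> braid_rels n"
    then consider (far) i j where "u = [Pos i, Pos j]" "v = [Pos j, Pos i]" "\<bar>int i - int j\<bar> \<ge> 2"
      | (braid) i where "u = [Pos i, Pos (i+1), Pos i]" "v = [Pos (i+1), Pos i, Pos (i+1)]"
      unfolding braid_rels_def by auto
    then show "word_val (sym_group n) (\<lambda>i. transpose i (i + 1)) u
      = word_val (sym_group n) (\<lambda>i. transpose i (i + 1)) v"
    proof cases
      case far
      have "transpose i (i + 1) \<circ> transpose j (j + 1) = transpose j (j + 1) \<circ> transpose i (i + 1)"
        using far(3) by (intro swap_id_independent) auto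
      then show ?thesis using far by (simp add: sym_group_mult sym_group_one)
    next
      case braid
      have "transpose i (i + 1) \<circ> (transpose (i + 1) (i + 2) \<circ> transpose i (i + 1))
        = transpose (i + 1) (i + 2) \<circ> (transpose i (i + 1) \<circ> transpose (i + 1) (i + 2))"
        by (auto simp: fun_eq_iff transpose_def)
      then show ?thesis using braid by (simp add: sym_group_mult sym_group_one)
    qed
  qed
qed

lemma braid_perm_hom: "braid_perm n \<in> hom (braid_group n) (sym_group n)"
  using presented_lift_locale.presented_lift_hom[OF transpose_presented_lift]
  by (simp add: braid_perm_def braid_group_def)

lemma braid_perm_gen: "i \<in> {1..n-1} \<Longrightarrow> braid_perm n (braid_gen n i) = transpose i (i + 1)"
  using presented_lift_locale.presented_lift_gen[OF transpose_presented_lift]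
  by (simp add: braid_perm_def braid_gen_def)

lemma subgroup_pure_braid: "subgroup (pure_braid n) (braid_group n)"
proof -
  interpret group_hom "braid_group n" "sym_group n" "braid_perm n"
    using group_braid_group sym_group_is_group braid_perm_hom
    by (simp add: group_hom_def group_hom_axioms_def)
  show ?thesis by (simp add: pure_braid_def subgroup_kernel)
qed

lemma braid_gen_square_pure:
  assumes "i \<in> {1..n-1}"
  shows "braid_gen n i \<otimes>\<^bsub>braid_group n\<^esub> braid_gen n i \<in> pure_braid n"
proof -
  interpret group "braid_group n" by (rule group_braid_group)
  have "braid_perm n (braid_gen n i \<otimes>\<^bsub>braid_group n\<^esub> braid_gen n i) = id"
    using assms
    by (simp add: hom_mult[OF braid_perm_hom] braid_gen_closed braid_perm_gen sym_group_mult)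
  then show ?thesis
    using assms by (simp add: pure_braid_def kernel_def braid_gen_closed sym_group_one)
qed

text \<open>In the product of the quotient by \<open>N\<close> with the symmetric group, the pairs formed from the
  generators satisfy the Coxeter relations, and the projection to the symmetric group is
  injective on the subgroup that they generate.\<close>
lemma pure_braid_subset_normal:
  assumes "N \<lhd> braid_group n"
    and sq: "\<And>i. i \<in> {1..n-1} \<Longrightarrow> braid_gen n i \<otimes>\<^bsub>braid_group n\<^esub> braid_gen n i \<in> N"
  shows "pure_braid n \<subseteq> N"
proof
  let ?B = "braid_group n" and ?\<sigma> = "braid_gen n" and ?S = "sym_group n"
  interpret N: normal N ?B by fact
  interpret Q: group "?B Mod N" by (rule N.factorgroup_is_group)
  interpret S: group ?S by (rule sym_group_is_group)
  let ?P = "(?B Mod N) \<times>\<times> ?S"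
  interpret P: group ?P by (intro DirProd_group Q.group_axioms S.group_axioms)
  define \<phi> where "\<phi> b = (N #>\<^bsub>?B\<^esub> b, braid_perm n b)" for b
  interpret \<phi>: group_hom ?B ?P \<phi>
  proof
    show "\<phi> \<in> hom ?B ?P"
      unfolding hom_pairwise \<phi>_def o_def using N.r_coset_hom_Mod braid_perm_hom[of n] by simp
  qed
  have mult: "\<phi> b \<otimes>\<^bsub>?P\<^esub> \<phi> c = \<phi> (b \<otimes>\<^bsub>?B\<^esub> c)" if "b \<in> carrier ?B" "c \<in> carrier ?B" for b c
    using that by simp
  interpret C: coxeter_generators ?P n snd "\<lambda>i. \<phi> (?\<sigma> i)" "n - 1"
  proof
    show "snd \<in> hom ?P ?S" by (auto simp: hom_def DirProd_def)
  next
    fix i assume i: "i \<in> {1..n-1}"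
    show "\<phi> (?\<sigma> i) \<in> carrier ?P" using i by (intro \<phi>.hom_closed braid_gen_closed)
    \<comment> \<open>The square of a generator lies in \<open>N\<close> and is pure, so both
      coordinates of its image are trivial.\<close>
    have "N #>\<^bsub>?B\<^esub> (?\<sigma> i \<otimes>\<^bsub>?B\<^esub> ?\<sigma> i) = N"
      by (rule N.rcos_const[OF group_braid_group sq[OF i]])
    then have "\<phi> (?\<sigma> i \<otimes>\<^bsub>?B\<^esub> ?\<sigma> i) = \<one>\<^bsub>?P\<^esub>"
      using braid_gen_square_pure[OF i]
      by (simp add: \<phi>_def pure_braid_def kernel_def one_DirProd FactGroup_def)
    then show "\<phi> (?\<sigma> i) \<otimes>\<^bsub>?P\<^esub> \<phi> (?\<sigma> i) = \<one>\<^bsub>?P\<^esub>"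
      by (simp only: mult braid_gen_closed[OF i])
    show "snd (\<phi> (?\<sigma> i)) = transpose i (i + 1)"
      using i by (simp add: \<phi>_def braid_perm_gen)
  next
    fix i j assume "i \<in> {1..n-1}" "j \<in> {1..n-1}" "i + 2 \<le> j"
    then show "\<phi> (?\<sigma> i) \<otimes>\<^bsub>?P\<^esub> \<phi> (?\<sigma> j) = \<phi> (?\<sigma> j) \<otimes>\<^bsub>?P\<^esub> \<phi> (?\<sigma> i)"
      using braid_gen_far[of i n j] by (simp only: mult braid_gen_closed)
  next
    fix i assume i: "i \<in> {1..n-1}" "i + 1 \<in> {1..n-1}"
    then show "\<phi> (?\<sigma> i) \<otimes>\<^bsub>?P\<^esub> (\<phi> (?\<sigma> (i + 1)) \<otimes>\<^bsub>?P\<^esub> \<phi> (?\<sigma> i))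
      = \<phi> (?\<sigma> (i + 1)) \<otimes>\<^bsub>?P\<^esub> (\<phi> (?\<sigma> i) \<otimes>\<^bsub>?P\<^esub> \<phi> (?\<sigma> (i + 1)))"
      using braid_gen_braid[OF i] by (simp only: mult braid_gen_closed N.m_closed)
  qed
  fix b assume "b \<in> pure_braid n"
  then have b: "b \<in> carrier ?B" "braid_perm n b = id"
    by (auto simp: pure_braid_def kernel_def sym_group_one)
  have "\<phi> ` carrier ?B = generate ?P (\<phi> ` ?\<sigma> ` {1..n-1})"
    using braid_gen_closed by (intro \<phi>.hom_image_generated braid_group_generated) auto
  then have "\<phi> b \<in> C.W (n - 1)"
    using b by (auto simp: C.W_def image_image)
  \<comment> \<open>Purity of \<open>b\<close> makes the second coordinate trivial; injectivity then
    kills the first, which places \<open>b\<close> in \<open>N\<close>.\<close>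
  then have "\<phi> b = \<one>\<^bsub>?P\<^esub>"
    by (rule C.h_injective) (simp_all add: b \<phi>_def)
  then have "N #>\<^bsub>?B\<^esub> b = N"
    by (simp add: \<phi>_def one_DirProd FactGroup_def)
  then show "b \<in> N"
    using N.rcos_self[OF b(1) N.is_subgroup] by simp
qed

section \<open>Injectivity criterion for the groups E\<close>

text \<open>The elements \<open>d i\<close> of the target detect the generators one at a time:
  \<open>d i\<close> commutes with the images of \<open>z\<close> and of all earlier
  \<open>x j\<close>, but not with that of \<open>x i\<close>. The disjunction in \<open>x_x\<close>
  treats commuting and anticommuting pairs uniformly.\<close>

locale E_like_generators = group_hom G H \<phi> for G (structure) and H \<phi> +
  fixes z :: 'a and x :: "nat \<Rightarrow> 'a" and d :: "nat \<Rightarrow> 'c" and m :: nat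
  assumes z_closed: "z \<in> carrier G"
    and z_sq: "z \<otimes> z = \<one>"
    and x_closed: "i \<in> {1..m} \<Longrightarrow> x i \<in> carrier G"
    and x_sq: "i \<in> {1..m} \<Longrightarrow> x i \<otimes> x i = z"
    and z_x: "i \<in> {1..m} \<Longrightarrow> x i \<otimes> z = z \<otimes> x i"
    and x_x: "\<lbrakk>i \<in> {1..m}; j \<in> {1..m}; j < i\<rbrakk> \<Longrightarrow>
      x i \<otimes> x j = x j \<otimes> x i \<or> x i \<otimes> x j = z \<otimes> (x j \<otimes> x i)"
    and d_closed: "i \<in> {1..m} \<Longrightarrow> d i \<in> carrier H"
    and d_z: "i \<in> {1..m} \<Longrightarrow> d i \<otimes>\<^bsub>H\<^esub> \<phi> z = \<phi> z \<otimes>\<^bsub>H\<^esub> d i"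
    and d_x_less: "\<lbrakk>i \<in> {1..m}; j \<in> {1..m}; j < i\<rbrakk> \<Longrightarrow> d i \<otimes>\<^bsub>H\<^esub> \<phi> (x j) = \<phi> (x j) \<otimes>\<^bsub>H\<^esub> d i"
    and d_x_eq: "i \<in> {1..m} \<Longrightarrow> d i \<otimes>\<^bsub>H\<^esub> \<phi> (x i) \<noteq> \<phi> (x i) \<otimes>\<^bsub>H\<^esub> d i"
    and \<phi>_z: "\<phi> z \<noteq> \<one>\<^bsub>H\<^esub>"
begin

definition V :: "nat \<Rightarrow> 'a set" where
  "V k = generate G (insert z (x ` {1..k}))"

lemma V_closed: "\<lbrakk>w \<in> V p; p \<le> m\<rbrakk> \<Longrightarrow> w \<in> carrier G"
  unfolding V_def using x_closed z_closed
  by (intro G.generate_in_carrier[of "insert z (x ` {1..p})"]) auto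

lemma V_mult: "\<lbrakk>v \<in> V p; w \<in> V p\<rbrakk> \<Longrightarrow> v \<otimes> w \<in> V p"
  by (simp add: V_def generate.eng)

lemma z_in_V: "z \<in> V p"
  by (simp add: V_def generate.incl)

lemma x_in_V: "\<lbrakk>1 \<le> i; i \<le> p\<rbrakk> \<Longrightarrow> x i \<in> V p"
  by (simp add: V_def generate.incl)

lemma z_inv: "inv z = z"
  using z_sq z_closed G.inv_equality by blast

lemma x_inv: "i \<in> {1..m} \<Longrightarrow> inv (x i) = x i \<otimes> z"
proof -
  assume i: "i \<in> {1..m}"
  have "(x i \<otimes> z) \<otimes> x i = z \<otimes> (x i \<otimes> x i)"
    using x_closed[OF i] z_closed by (simp add: z_x[OF i] G.m_assoc)
  also have "\<dots> = \<one>" using x_sq[OF i] z_sq by simp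
  finally show ?thesis
    using i x_closed z_closed by (intro G.inv_equality) auto
qed

text \<open>Moving a generator of \<open>V p\<close> leftwards past \<open>x (Suc p)\<close> costs
  at most a factor \<open>z\<close>, and \<open>x (Suc p)\<close> squares to \<open>z\<close>. So
  \<open>V p\<close> and its coset by \<open>x (Suc p)\<close> together are stable under right
  multiplication.\<close>

lemma V_normal_form:
  assumes "Suc p \<le> m" "g \<in> V (Suc p)"
  shows "g \<in> V p \<or> (\<exists>w\<in>V p. g = w \<otimes> x (Suc p))"
proof -
  define D where "D = V p \<union> (\<lambda>w. w \<otimes> x (Suc p)) ` V p"
  let ?y = "x (Suc p)"
  have y: "?y \<in> carrier G" using assms by (intro x_closed) auto
  have V_sub: "V p \<subseteq> carrier G" using V_closed[of _ p] assms by auto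
  then have D: "D \<subseteq> carrier G" using y by (auto simp: D_def)
  have shift: "(w \<otimes> ?y) \<otimes> t \<in> D"
    if "w \<in> V p" "t \<in> carrier G" "?y \<otimes> t = v \<otimes> ?y" "v \<in> V p" for w t v
  proof -
    have "w \<in> carrier G" "v \<in> carrier G" using that V_sub by auto
    then have "(w \<otimes> ?y) \<otimes> t = (w \<otimes> v) \<otimes> ?y"
      using that y by (simp add: G.m_assoc)
    then show ?thesis using V_mult that by (auto simp: D_def)
  qed
  have step_z: "c \<otimes> z \<in> D" if "c \<in> D" for c
    using that V_mult[OF _ z_in_V] shift[of _ z z] z_closed z_x[of "Suc p"] z_in_V assms
    by (auto simp: D_def)
  have step_x: "c \<otimes> x i \<in> D" if c: "c \<in> D" and i: "1 \<le> i" "i \<le> Suc p" for c i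
  proof (cases "i = Suc p")
    case True
    have "(w \<otimes> ?y) \<otimes> ?y = w \<otimes> z" if "w \<in> V p" for w
      using that V_sub y x_sq[of "Suc p"] assms by (auto simp: G.m_assoc)
    then show ?thesis
      using c True V_mult[OF _ z_in_V, of _ p] by (auto simp: D_def)
  next
    case False
    then have xi: "x i \<in> V p" "x i \<in> carrier G"
      using i x_in_V x_closed[of i] assms by auto
    have "?y \<otimes> x i = x i \<otimes> ?y \<or> ?y \<otimes> x i = (z \<otimes> x i) \<otimes> ?y"
      using x_x[of "Suc p" i] i False assms xi y z_closed by (auto simp: G.m_assoc)
    then obtain v where "v \<in> V p" "?y \<otimes> x i = v \<otimes> ?y"
      using xi V_mult z_in_V by metis
    then have "w \<otimes> ?y \<otimes> x i \<in> D" if "w \<in> V p" for w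
      using that shift xi by blast
    then show ?thesis using c V_mult[OF _ xi(1)] by (auto simp: D_def)
  qed
  have "\<one> \<in> D" by (simp add: D_def V_def generate.one)
  have "\<one> \<otimes> g \<in> D"
  proof (rule generate_mult_closed[OF G.is_group _ _ _ D _ \<open>\<one> \<in> D\<close>])
    show "g \<in> generate G (insert z (x ` {1..Suc p}))" using assms by (simp add: V_def)
    fix c t assume c: "c \<in> D" and t: "t \<in> insert z (x ` {1..Suc p})"
    show "c \<otimes> t \<in> D" using c t step_z step_x by auto
    \<comment> \<open>Since \<open>z\<close> is its own inverse and \<open>x i\<close> has inverse
      \<open>x i \<otimes> z\<close>, inverses reduce to the multiplications already
      treated.\<close>
    consider "t = z" | i where "t = x i" "1 \<le> i" "i \<le> Suc p" using t by auto
    then show "c \<otimes> inv t \<in> D"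
    proof cases
      case 1
      then show ?thesis using step_z c by (simp add: z_inv)
    next
      case 2
      then have "c \<otimes> inv t = (c \<otimes> x i) \<otimes> z"
        using c D x_closed[of i] z_closed assms by (auto simp: x_inv G.m_assoc)
      then show ?thesis using step_z step_x c 2 by simp
    qed
  qed (use x_closed z_closed assms in auto)
  moreover have "g \<in> carrier G" using assms V_closed by blast
  ultimately show ?thesis by (auto simp: D_def)
qed

text \<open>The preimage under \<open>\<phi>\<close> of the centralizer of \<open>d (Suc p)\<close>
  is a subgroup that contains the generators of \<open>V p\<close>.\<close>

lemma d_V_commute:
  assumes "w \<in> V p" "Suc p \<le> m"
  shows "d (Suc p) \<otimes>\<^bsub>H\<^esub> \<phi> w = \<phi> w \<otimes>\<^bsub>H\<^esub> d (Suc p)"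
proof -
  let ?d = "d (Suc p)" and ?C = "{w \<in> carrier G. d (Suc p) \<otimes>\<^bsub>H\<^esub> \<phi> w = \<phi> w \<otimes>\<^bsub>H\<^esub> d (Suc p)}"
  have d: "?d \<in> carrier H" using assms by (intro d_closed) auto
  have "subgroup ?C G"
  proof (rule G.subgroupI)
    fix a assume "a \<in> ?C"
    then show "inv a \<in> ?C"
      using d by (auto simp: H.inv_solve_left H.m_assoc[symmetric])
        (metis H.inv_closed H.m_assoc H.r_inv H.r_one hom_closed)
  next
    fix a b assume a: "a \<in> ?C" and b: "b \<in> ?C"
    then have "?d \<otimes>\<^bsub>H\<^esub> (\<phi> a \<otimes>\<^bsub>H\<^esub> \<phi> b) = (\<phi> a \<otimes>\<^bsub>H\<^esub> ?d) \<otimes>\<^bsub>H\<^esub> \<phi> b"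
      using d by (simp add: H.m_assoc[symmetric])
    also have "\<dots> = \<phi> a \<otimes>\<^bsub>H\<^esub> (\<phi> b \<otimes>\<^bsub>H\<^esub> ?d)"
      using a b d by (simp add: H.m_assoc)
    also have "\<dots> = (\<phi> a \<otimes>\<^bsub>H\<^esub> \<phi> b) \<otimes>\<^bsub>H\<^esub> ?d"
      using a b d by (simp add: H.m_assoc)
    finally show "a \<otimes> b \<in> ?C" using a b by simp
  qed (use d in auto)
  moreover have "insert z (x ` {1..p}) \<subseteq> ?C"
    using x_closed z_closed d_z[of "Suc p"] d_x_less[of "Suc p"] assms by auto
  ultimately have "generate G (insert z (x ` {1..p})) \<subseteq> ?C"
    by (intro G.generate_subgroup_incl)
  then show ?thesis using assms by (auto simp: V_def)
qed

text \<open>If \<open>w \<otimes> x (Suc p)\<close> maps to the identity, the image of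
  \<open>x (Suc p)\<close> is inverse to that of \<open>w\<close>, hence commutes with
  \<open>d (Suc p)\<close>, against \<open>d_x_eq\<close>. Thus \<open>g\<close> lies in
  \<open>V p\<close> and the induction continues.\<close>

lemma \<phi>_injective:
  assumes "g \<in> V p" "p \<le> m" "\<phi> g = \<one>\<^bsub>H\<^esub>"
  shows "g = \<one>"
  using assms
proof (induction p arbitrary: g)
  case 0
  \<comment> \<open>At the bottom of the chain only \<open>\<one>\<close> and \<open>z\<close>
    remain, and \<open>\<phi>_z\<close> excludes \<open>z\<close>.\<close>
  have "generate G {z} \<subseteq> {\<one>, z}"
    using z_closed z_sq
    by (intro G.generate_subgroup_incl G.subgroupI) (auto simp: z_inv)
  then show ?case using 0 \<phi>_z by (auto simp: V_def)
next
  case (Suc p)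
  let ?y = "x (Suc p)" and ?d = "d (Suc p)"
  have y: "?y \<in> carrier G" "?d \<in> carrier H"
    using Suc.prems by (auto intro: x_closed d_closed)
  consider "g \<in> V p" | w where "w \<in> V p" "g = w \<otimes> ?y"
    using V_normal_form Suc.prems by blast
  then show ?case
  proof cases
    case 1
    then show ?thesis using Suc by simp
  next
    case 2
    then have w: "w \<in> carrier G" using V_closed[of w p] Suc.prems by auto
    have e: "\<phi> w \<otimes>\<^bsub>H\<^esub> \<phi> ?y = \<one>\<^bsub>H\<^esub>" using 2 w y Suc.prems by simp
    have "\<phi> w \<otimes>\<^bsub>H\<^esub> (?d \<otimes>\<^bsub>H\<^esub> \<phi> ?y) = ?d \<otimes>\<^bsub>H\<^esub> (\<phi> w \<otimes>\<^bsub>H\<^esub> \<phi> ?y)"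
      using d_V_commute[OF 2(1)] Suc.prems w y by (simp add: H.m_assoc[symmetric])
    also have "\<dots> = \<phi> w \<otimes>\<^bsub>H\<^esub> (\<phi> ?y \<otimes>\<^bsub>H\<^esub> ?d)"
      using e w y by (simp add: H.m_assoc[symmetric])
    finally have "?d \<otimes>\<^bsub>H\<^esub> \<phi> ?y = \<phi> ?y \<otimes>\<^bsub>H\<^esub> ?d"
      using w y by simp
    then show ?thesis using d_x_eq[of "Suc p"] Suc.prems by simp
  qed
qed

end

section \<open>Signed permutation matrices\<close>

unbundle bit_operations_syntax

text \<open>The monomial matrix that sends the basis vector \<open>c\<close> to \<open>f c\<close>
  times the basis vector \<open>c XOR a\<close>. Bit \<open>k\<close> of an index belongs to tensor
  factor \<open>k + 1\<close>, so matrix identities become identities about bits and signs.\<close>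

definition xor_shift_mat :: "nat \<Rightarrow> nat \<Rightarrow> (nat \<Rightarrow> complex) \<Rightarrow> complex mat" where
  "xor_shift_mat n a f = mat (2 ^ n) (2 ^ n) (\<lambda>(r, c). if r = c XOR a then f c else 0)"

lemma xor_less_power2: "\<lbrakk>a < 2 ^ n; b < 2 ^ n\<rbrakk> \<Longrightarrow> a XOR b < (2 ^ n :: nat)"
  using take_bit_nat_less_exp[of n "a XOR b"] by (simp add: take_bit_nat_eq_self)

lemma xor_shift_mat_carrier [simp]: "xor_shift_mat n a f \<in> carrier_mat (2 ^ n) (2 ^ n)"
  by (simp add: xor_shift_mat_def)

text \<open>In column \<open>c\<close> the only contributing intermediate index is
  \<open>c XOR b\<close>, which \<open>b < 2 ^ n\<close> keeps in range.\<close>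

lemma xor_shift_mat_mult:
  assumes "b < 2 ^ n"
  shows "xor_shift_mat n a f * xor_shift_mat n b g = xor_shift_mat n (b XOR a) (\<lambda>c. f (c XOR b) * g c)"
proof (rule eq_matI)
  fix r c assume "r < dim_row (xor_shift_mat n (b XOR a) (\<lambda>c. f (c XOR b) * g c))"
    "c < dim_col (xor_shift_mat n (b XOR a) (\<lambda>c. f (c XOR b) * g c))"
  then have rc: "r < 2 ^ n" "c < 2 ^ n" by (simp_all add: xor_shift_mat_def)
  have "(xor_shift_mat n a f * xor_shift_mat n b g) $$ (r, c)
    = (\<Sum>k<2 ^ n. (if r = k XOR a then f k else 0) * (if k = c XOR b then g c else 0))"
    using rc by (simp add: xor_shift_mat_def scalar_prod_def atLeast0LessThan)
  also have "\<dots> = (\<Sum>k<2 ^ n. if k = c XOR b then (if r = k XOR a then f k else 0) * g c else 0)"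
    by (intro sum.cong) auto
  also have "\<dots> = (if r = c XOR b XOR a then f (c XOR b) else 0) * g c"
    using xor_less_power2[OF rc(2) assms] by (simp add: xor.assoc)
  finally show "(xor_shift_mat n a f * xor_shift_mat n b g) $$ (r, c) = xor_shift_mat n (b XOR a) (\<lambda>c. f (c XOR b) * g c) $$ (r, c)"
    using rc by (simp add: xor_shift_mat_def)
qed (simp_all add: xor_shift_mat_def)

lemma xor_shift_mat_cong:
  "\<lbrakk>a = b; \<And>c. c < 2 ^ n \<Longrightarrow> f c = g c\<rbrakk> \<Longrightarrow> xor_shift_mat n a f = xor_shift_mat n b g"
  by (rule eq_matI) (auto simp: xor_shift_mat_def)

lemma xor_shift_mat_uminus: "- xor_shift_mat n a f = xor_shift_mat n a (\<lambda>c. - f c)"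
  by (rule eq_matI) (auto simp: xor_shift_mat_def)

lemma xor_shift_mat_one: "1\<^sub>m (2 ^ n) = xor_shift_mat n 0 (\<lambda>_. 1)"
  by (rule eq_matI) (auto simp: xor_shift_mat_def)

section \<open>The matrices \<open>S_mat\<close> and \<open>D_mat\<close> and their
  relations\<close>

lemma bit_push_bit_3: "bit (push_bit a 3 :: nat) j \<longleftrightarrow> j = a \<or> j = Suc a"
proof -
  have three: "(3 :: nat) = mask 2" by (simp add: mask_eq_exp_minus_1)
  have "bit (push_bit a 3 :: nat) j \<longleftrightarrow> a \<le> j \<and> j - a < 2"
    unfolding three bit_push_bit_iff bit_mask_iff by simp
  also have "\<dots> \<longleftrightarrow> j = a \<or> j = Suc a" by linarith
  finally show ?thesis .
qed

text \<open>With \<open>S = sqrt 2 R - 1\<close>, this is \<open>I^(i-1) \<otimes> S \<otimes> I^(n-i-1)\<close>: it flips the bits \<open>i - 1\<close> and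
  \<open>i\<close> of the index of a basis vector, with a sign given by bit \<open>i - 1\<close>.\<close>
definition S_mat :: "nat \<Rightarrow> nat \<Rightarrow> complex mat" where
  "S_mat n i = xor_shift_mat n (push_bit (i - 1) 3) (\<lambda>c. if bit c (i - 1) then 1 else -1)"

text \<open>The sign sits on tensor factor \<open>i + 1\<close>, the later of the two factors on
  which \<open>S_mat n i\<close> acts, out of reach of every \<open>S_mat n j\<close> with
  \<open>j < i\<close>.\<close>

definition D_mat :: "nat \<Rightarrow> nat \<Rightarrow> complex mat" where
  "D_mat n i = xor_shift_mat n 0 (\<lambda>c. if bit c i then -1 else 1)"

lemma S_mat_carrier [simp]: "S_mat n i \<in> carrier_mat (2 ^ n) (2 ^ n)"
  by (simp add: S_mat_def)

lemma D_mat_carrier [simp]: "D_mat n i \<in> carrier_mat (2 ^ n) (2 ^ n)"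
  by (simp add: D_mat_def)

lemma push_bit_3_less:
  assumes "i \<in> {1..n-1}"
  shows "push_bit (i - 1) 3 < (2 ^ n :: nat)"
proof -
  have "push_bit (i - 1) 3 < 2 ^ (i - 1) * (4 :: nat)" by (simp add: push_bit_eq_mult)
  also have "\<dots> = 2 ^ Suc i" using assms by (cases i) simp_all
  also have "\<dots> \<le> 2 ^ n" using assms by (intro power_increasing) auto
  finally show ?thesis .
qed

text \<open>The two flips cancel, while the sign bit takes both values, so the two signs multiply to
  \<open>-1\<close>.\<close>

lemma S_mat_square:
  assumes "i \<in> {1..n-1}"
  shows "S_mat n i * S_mat n i = - 1\<^sub>m (2 ^ n)"
  unfolding S_mat_def xor_shift_mat_mult[OF push_bit_3_less[OF assms]] xor_shift_mat_one xor_shift_mat_uminus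
  by (rule xor_shift_mat_cong) (simp_all add: bit_xor_iff bit_push_bit_3)

lemma S_mat_far:
  assumes "i \<in> {1..n-1}" "j \<in> {1..n-1}" "i + 2 \<le> j"
  shows "S_mat n i * S_mat n j = S_mat n j * S_mat n i"
proof -
  have "i - 1 \<noteq> j - 1" "i \<noteq> j - 1" "j \<noteq> i - 1" using assms by auto
  then show ?thesis
    unfolding S_mat_def xor_shift_mat_mult[OF push_bit_3_less[OF assms(1)]]
      xor_shift_mat_mult[OF push_bit_3_less[OF assms(2)]]
    using assms by (intro xor_shift_mat_cong xor.commute) (simp add: bit_xor_iff bit_push_bit_3)
qed

text \<open>\<open>S_mat n i\<close> flips bit \<open>i\<close>, from which
  \<open>S_mat n (i + 1)\<close> reads its sign, but \<open>S_mat n (i + 1)\<close> leaves bit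
  \<open>i - 1\<close> alone. Exactly one sign depends on the order.\<close>

lemma S_mat_near:
  assumes "i \<in> {1..n-1}" "i + 1 \<in> {1..n-1}"
  shows "S_mat n (i + 1) * S_mat n i = - (S_mat n i * S_mat n (i + 1))"
proof -
  have "i - 1 \<noteq> i" using assms by auto
  then show ?thesis
    unfolding S_mat_def xor_shift_mat_mult[OF push_bit_3_less[OF assms(1)]]
      xor_shift_mat_mult[OF push_bit_3_less[OF assms(2)]] xor_shift_mat_uminus
    using assms by (intro xor_shift_mat_cong xor.commute) (simp add: bit_xor_iff bit_push_bit_3)
qed

lemma D_mat_square: "D_mat n i * D_mat n i = 1\<^sub>m (2 ^ n)"
proof -
  have z: "0 < (2 ^ n :: nat)" by simp
  show ?thesis
    unfolding D_mat_def xor_shift_mat_mult[OF z] xor_shift_mat_one by (rule xor_shift_mat_cong) simp_all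
qed

lemma D_mat_S_mat_less:
  assumes "j \<in> {1..n-1}" "j < i"
  shows "D_mat n i * S_mat n j = S_mat n j * D_mat n i"
proof -
  have z: "0 < (2 ^ n :: nat)" by simp
  have "i \<noteq> j - 1" "i \<noteq> Suc (j - 1)" using assms by auto
  then show ?thesis
    unfolding S_mat_def D_mat_def xor_shift_mat_mult[OF z] xor_shift_mat_mult[OF push_bit_3_less[OF assms(1)]]
    by (intro xor_shift_mat_cong) (simp_all add: bit_xor_iff bit_push_bit_3)
qed

text \<open>\<open>S_mat n i\<close> flips the very bit from which \<open>D_mat n i\<close> reads
  its sign.\<close>

lemma D_mat_S_mat_eq:
  assumes "i \<in> {1..n-1}"
  shows "D_mat n i * S_mat n i = - (S_mat n i * D_mat n i)"
proof -
  have z: "0 < (2 ^ n :: nat)" by simp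
  have "bit (push_bit (i - 1) 3 :: nat) i"
    unfolding bit_push_bit_3 using assms by auto
  then show ?thesis
    unfolding S_mat_def D_mat_def xor_shift_mat_mult[OF z] xor_shift_mat_mult[OF push_bit_3_less[OF assms(1)]]
      xor_shift_mat_uminus
    by (intro xor_shift_mat_cong) (simp_all add: bit_xor_iff)
qed

section \<open>Tensor products and the matrix of a braid generator\<close>

lemma tensor_mat_one: "p > 0 \<Longrightarrow> tensor_mat (1\<^sub>m p) (1\<^sub>m q) = 1\<^sub>m (p * q)"
proof (rule eq_matI)
  fix r c assume p: "p > 0" and "r < dim_row (1\<^sub>m (p * q) :: complex mat)" "c < dim_col (1\<^sub>m (p * q) :: complex mat)"
  then have rc: "r < p * q" "c < p * q" by simp_all
  have "r = c \<longleftrightarrow> r div p = c div p \<and> r mod p = c mod p"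
    by (metis div_mult_mod_eq)
  then show "tensor_mat (1\<^sub>m p) (1\<^sub>m q) $$ (r, c) = 1\<^sub>m (p * q) $$ (r, c)"
    using rc p by (auto simp: tensor_mat_def less_mult_imp_div_less mult.commute)
qed (simp_all add: tensor_mat_def)

lemma tensor_power_one: "tensor_power (1\<^sub>m 2) k = 1\<^sub>m (2 ^ k)"
  by (induction k) (simp_all add: tensor_mat_one mult.commute)

text \<open>The splitting of \<open>sqrt 2 R\<close> into its diagonal and antidiagonal: on two bits
  \<open>v XOR 3\<close> is \<open>3 - v\<close>, and the low bit of the column gives the
  sign.\<close>

lemma R_mat_index:
  assumes "u < 4" "v < 4"
  shows "R_mat $$ (u, v) = complex_of_real (1 / sqrt 2) *
    ((if u = v then 1 else 0) + (if u = v XOR 3 then (if odd v then 1 else -1) else 0))"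
proof -
  have "u = 0 \<or> u = 1 \<or> u = 2 \<or> u = 3" "v = 0 \<or> v = 1 \<or> v = 2 \<or> v = 3"
    using assms by arith+
  moreover have "(1 :: nat) XOR 3 = 2" "(2 :: nat) XOR 3 = 1" by simp_all
  ultimately show ?thesis
    by (elim disjE) (simp_all add: R_mat_def mat_of_rows_list_def)
qed

lemma R_mat_dim [simp]: "dim_row R_mat = 4" "dim_col R_mat = 4"
  by (simp_all add: R_mat_def mat_of_rows_list_def)

text \<open>An index splits into \<open>b\<close> high, two middle and \<open>a\<close> low bits,
  one block for each of the three tensor factors. The identity factors compare the high and low
  blocks, and \<open>R_mat_index\<close> evaluates the middle one.\<close>

lemma braid_rep_gen_eq:
  assumes "i \<in> {1..n-1}"
  shows "braid_rep_gen n i = complex_of_real (1 / sqrt 2) \<cdot>\<^sub>m (1\<^sub>m (2 ^ n) + S_mat n i)"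
proof (rule eq_matI)
  obtain a where a: "i = Suc a" using assms by (cases i) auto
  define b where "b = n - i - 1"
  have n: "n = a + 2 + b" using assms a by (auto simp: b_def)
  have pow: "2 ^ a * 4 * 2 ^ b = (2 ^ n :: nat)" by (simp add: n power_add)
  let ?M = "complex_of_real (1 / sqrt 2) \<cdot>\<^sub>m (1\<^sub>m (2 ^ n) + S_mat n i)"
  have B: "braid_rep_gen n i = tensor_mat (tensor_mat (1\<^sub>m (2 ^ a)) R_mat) (1\<^sub>m (2 ^ b))"
    by (simp add: braid_rep_gen_def tensor_power_one a b_def)
  have dimM: "dim_row ?M = 2 ^ n" "dim_col ?M = 2 ^ n" by (simp_all add: S_mat_def xor_shift_mat_def)
  show "dim_row (braid_rep_gen n i) = dim_row ?M" "dim_col (braid_rep_gen n i) = dim_col ?M"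
    unfolding dimM by (simp_all add: B tensor_mat_def pow)
  fix r c assume "r < dim_row ?M" "c < dim_col ?M"
  then have rc: "r < 2 ^ n" "c < 2 ^ n" unfolding dimM by simp_all
  let ?hi = "\<lambda>x::nat. drop_bit (a + 2) x" and ?mid = "\<lambda>x::nat. take_bit 2 (drop_bit a x)"
    and ?lo = "\<lambda>x::nat. take_bit a x"
  have parts: "x div (2 ^ a * 4) = ?hi x" "x mod (2 ^ a * 4) div 2 ^ a = ?mid x"
    "x mod (2 ^ a * 4) mod 2 ^ a = ?lo x" for x
  proof -
    show "x div (2 ^ a * 4) = ?hi x" by (simp add: drop_bit_eq_div power_add mult.commute)
    show "x mod (2 ^ a * 4) div 2 ^ a = ?mid x" "x mod (2 ^ a * 4) mod 2 ^ a = ?lo x"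
      unfolding mod_mult2_eq by (simp_all add: drop_bit_eq_div take_bit_eq_mod)
  qed
  have decomp: "x = y \<longleftrightarrow> ?hi x = ?hi y \<and> ?mid x = ?mid y \<and> ?lo x = ?lo y" for x y
  proof -
    have eq: "x = x div (2 ^ a * 4) * (2 ^ a * 4)
        + (x mod (2 ^ a * 4) div 2 ^ a * 2 ^ a + x mod (2 ^ a * 4) mod 2 ^ a)" for x :: nat
      by (simp only: div_mult_mod_eq)
    show ?thesis using eq[of x, unfolded parts] eq[of y, unfolded parts] by metis
  qed
  have mid: "?mid x < 4" for x
    using take_bit_nat_less_exp[of 2 "drop_bit a x"] by simp
  have hi: "?hi x < 2 ^ b" if "x < 2 ^ n" for x
  proof -
    have "2 ^ n = 2 ^ b * (2 ^ (a + 2) :: nat)" by (simp add: n power_add)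
    then show ?thesis
      using that by (simp only: drop_bit_eq_div less_mult_imp_div_less)
  qed
  \<comment> \<open>The shifted mask touches the middle block only, so the flip in
    \<open>S_mat\<close> is the flip in \<open>R_mat_index\<close>.\<close>
  have "?hi (c XOR push_bit a 3) = ?hi c" "?lo (c XOR push_bit a 3) = ?lo c"
    "?mid (c XOR push_bit a 3) = ?mid c XOR 3"
    by (simp_all add: take_bit_push_bit drop_bit_push_bit)
  then have flip: "r = c XOR push_bit a 3 \<longleftrightarrow> ?hi r = ?hi c \<and> ?mid r = ?mid c XOR 3 \<and> ?lo r = ?lo c"
    by (simp add: decomp[of r])
  \<comment> \<open>The low bit of the middle block is bit \<open>a = i - 1\<close> of the whole
    index, the sign bit of \<open>S_mat n i\<close>.\<close>
  have sign: "odd (drop_bit a c) \<longleftrightarrow> bit c a"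
    by (simp add: bit_iff_odd_drop_bit)
  have "braid_rep_gen n i $$ (r, c) = 1\<^sub>m (2 ^ b) $$ (?hi r, ?hi c)
      * (R_mat $$ (?mid r, ?mid c) * 1\<^sub>m (2 ^ a) $$ (?lo r, ?lo c))"
    unfolding B using rc
    by (simp add: tensor_mat_def pow parts)
  also have "\<dots> = ?M $$ (r, c)"
    using rc mid hi
    by (auto simp: R_mat_index S_mat_def xor_shift_mat_def a flip sign decomp[of r c])
  finally show "braid_rep_gen n i $$ (r, c) = ?M $$ (r, c)" .
qed

unbundle no bit_operations_syntax

section \<open>Images of the braid generators\<close>

text \<open>When \<open>A * A = - 1\<close> this is the exponential of \<open>pi A / 4\<close>.
  Hence it squares to \<open>A\<close>, and replacing \<open>A\<close> by \<open>- A\<close> inverts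
  it.\<close>

definition braiding :: "nat \<Rightarrow> complex mat \<Rightarrow> complex mat" where
  "braiding N A = complex_of_real (1 / sqrt 2) \<cdot>\<^sub>m (1\<^sub>m N + A)"

lemma braiding_carrier [simp]: "A \<in> carrier_mat N N \<Longrightarrow> braiding N A \<in> carrier_mat N N"
  by (simp add: braiding_def)

lemma sqrt_half_square: "complex_of_real (1 / sqrt 2) * complex_of_real (1 / sqrt 2) = 1 / 2"
  by (simp flip: of_real_mult)

lemma braiding_mult:
  assumes [simp]: "A \<in> carrier_mat N N" "B \<in> carrier_mat N N"
  shows "braiding N A * braiding N B = (1 / 2) \<cdot>\<^sub>m ((1\<^sub>m N + B) + (A + A * B))"
proof -
  have "braiding N A * braiding N B
    = (complex_of_real (1 / sqrt 2) * complex_of_real (1 / sqrt 2)) \<cdot>\<^sub>m ((1\<^sub>m N + A) * (1\<^sub>m N + B))"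
    unfolding braiding_def
    by (subst mult_smult_assoc_mat[where nr = N and n = N and nc = N], simp, simp,
        subst mult_smult_distrib[where nr = N and n = N and nc = N])
       (use assms in \<open>auto intro!: eq_matI\<close>)
  also have "(1\<^sub>m N + A) * (1\<^sub>m N + B) = 1\<^sub>m N * (1\<^sub>m N + B) + A * (1\<^sub>m N + B)"
    by (rule add_mult_distrib_mat[where nr = N and n = N and nc = N]) simp_all
  also have "A * (1\<^sub>m N + B) = A * 1\<^sub>m N + A * B"
    by (rule mult_add_distrib_mat[where nr = N and n = N and nc = N]) simp_all
  finally show ?thesis
    unfolding sqrt_half_square using carrier_matD[OF assms(1)] carrier_matD[OF assms(2)] by simp
qed

lemma braiding_square:
  assumes A: "A \<in> carrier_mat N N" "A * A = - 1\<^sub>m N"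
  shows "braiding N A * braiding N A = A"
  unfolding braiding_mult[OF A(1) A(1)] A(2)
  by (rule eq_matI) (use A(1) in auto)

lemma uminus_square:
  fixes A :: "'a :: ring_1 mat"
  assumes "A \<in> carrier_mat N N" and "A * A = - 1\<^sub>m N"
  shows "(- A) * (- A) = - 1\<^sub>m N" "A * (- A) = 1\<^sub>m N"
  using assms(2) carrier_matD[OF assms(1)]
  by (simp_all)

lemma braiding_inverse:
  assumes A: "A \<in> carrier_mat N N" "A * A = - 1\<^sub>m N"
  shows "braiding N A * braiding N (- A) = 1\<^sub>m N"
proof -
  have "- A \<in> carrier_mat N N" using A by simp
  then show ?thesis
    unfolding braiding_mult[OF A(1) \<open>- A \<in> carrier_mat N N\<close>] uminus_square(2)[OF A]
    by (intro eq_matI) (use A(1) in auto)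
qed

lemma braiding_commute:
  assumes A: "A \<in> carrier_mat N N" "B \<in> carrier_mat N N" "A * B = B * A"
  shows "braiding N A * braiding N B = braiding N B * braiding N A"
  unfolding braiding_mult[OF A(1,2)] braiding_mult[OF A(2,1)] A(3)
  by (rule eq_matI) (use A(1,2) in \<open>auto simp del: index_mult_mat(1)\<close>)

lemma braiding_mult_left:
  assumes [simp]: "A \<in> carrier_mat N N" "B \<in> carrier_mat N N"
  shows "braiding N B * A = complex_of_real (1 / sqrt 2) \<cdot>\<^sub>m (A + B * A)"
proof -
  have "braiding N B * A = complex_of_real (1 / sqrt 2) \<cdot>\<^sub>m ((1\<^sub>m N + B) * A)"
    unfolding braiding_def by (rule mult_smult_assoc_mat[where nr = N and n = N and nc = N]) simp_all
  also have "(1\<^sub>m N + B) * A = 1\<^sub>m N * A + B * A"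
    by (rule add_mult_distrib_mat[where nr = N and n = N and nc = N]) simp_all
  finally show ?thesis using carrier_matD[OF assms(1)] carrier_matD[OF assms(2)] by simp
qed

lemma braiding_mult_right:
  assumes [simp]: "A \<in> carrier_mat N N" "B \<in> carrier_mat N N"
  shows "A * braiding N B = complex_of_real (1 / sqrt 2) \<cdot>\<^sub>m (A + A * B)"
proof -
  have "A * braiding N B = complex_of_real (1 / sqrt 2) \<cdot>\<^sub>m (A * (1\<^sub>m N + B))"
    unfolding braiding_def by (rule mult_smult_distrib[where nr = N and n = N and nc = N]) simp_all
  also have "A * (1\<^sub>m N + B) = A * 1\<^sub>m N + A * B"
    by (rule mult_add_distrib_mat[where nr = N and n = N and nc = N]) simp_all
  finally show ?thesis using carrier_matD[OF assms(1)] carrier_matD[OF assms(2)] by simp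
qed

lemma anticommute_sandwich:
  fixes A B :: "'a :: ring_1 mat"
  assumes A: "A \<in> carrier_mat N N" and B: "B \<in> carrier_mat N N"
    and sq: "B * B = - 1\<^sub>m N" and anti: "B * A = - (A * B)"
  shows "B * A * B = A"
proof -
  have "B * A * B = - (A * B * B)"
    unfolding anti using A B by simp
  also have "A * B * B = A * (B * B)"
    using A B by (intro assoc_mult_mat) auto
  also have "- (A * (B * B)) = A"
    unfolding sq using carrier_matD[OF A] by simp
  finally show ?thesis .
qed

text \<open>Both sides expand to \<open>(A + B * A) / sqrt 2\<close>, because
  \<open>B * A * B = A\<close>. So conjugation by the braiding of \<open>B\<close> turns
  \<open>A\<close> into \<open>B * A\<close>.\<close>

lemma braiding_conj_anti:
  assumes A: "A \<in> carrier_mat N N" and B: "B \<in> carrier_mat N N"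
    and "B * B = - 1\<^sub>m N" "B * A = - (A * B)"
  shows "braiding N B * A = (B * A) * braiding N B"
proof -
  have BA: "B * A \<in> carrier_mat N N" using A B by simp
  show ?thesis
    unfolding braiding_mult_left[OF A B] braiding_mult_right[OF BA B] anticommute_sandwich[OF assms]
    using A BA by (simp add: comm_add_mat)
qed

lemma braiding_conj_comm:
  assumes A: "A \<in> carrier_mat N N" and B: "B \<in> carrier_mat N N" and "B * A = A * B"
  shows "braiding N B * A = A * braiding N B"
  unfolding braiding_mult_left[OF A B] braiding_mult_right[OF A B] assms(3) ..

text \<open>In the expansion \<open>1\<close> cancels against \<open>A * A\<close> and
  \<open>A * B\<close> against \<open>B * A\<close>, while \<open>A\<close> and \<open>B\<close>
  each occur twice. The result is symmetric in \<open>A\<close> and \<open>B\<close>, which yields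
  the braid relation.\<close>

lemma braiding_triple:
  assumes A: "A \<in> carrier_mat N N" and B: "B \<in> carrier_mat N N"
    and sqA: "A * A = - 1\<^sub>m N" and anti: "B * A = - (A * B)"
  shows "braiding N A * (braiding N B * braiding N A) = complex_of_real (1 / sqrt 2) \<cdot>\<^sub>m (A + B)"
proof -
  have AB: "A * B \<in> carrier_mat N N" using A B by simp
  have A_BA: "A * (B * A) = B"
  proof -
    have AB_anti: "A * B = - (B * A)" using A B by (simp add: anti)
    have "A * (B * A) = A * B * A" using A B by (simp add: assoc_mult_mat)
    then show ?thesis using anticommute_sandwich[OF B A sqA AB_anti] by simp
  qed
  let ?M = "(1\<^sub>m N + A) + (B + B * A)"
  have M: "?M \<in> carrier_mat N N" using A B by simp
  have "braiding N A * (braiding N B * braiding N A)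
    = (1 / 2) \<cdot>\<^sub>m (braiding N A * ?M)"
    unfolding braiding_mult[OF B A] using M A
    by (intro mult_smult_distrib[where nr = N and n = N and nc = N]) auto
  also have "A * ?M = A * (1\<^sub>m N + A) + A * (B + B * A)"
    using A B by (intro mult_add_distrib_mat[where nr = N and n = N and nc = N]) auto
  then have "A * ?M = (A + A * A) + (A * B + A * (B * A))"
    using A B mult_add_distrib_mat[of A N N "1\<^sub>m N" N A] mult_add_distrib_mat[of A N N B N "B * A"]
    by simp
  then have "braiding N A * ?M
      = complex_of_real (1 / sqrt 2) \<cdot>\<^sub>m (?M + ((A + - 1\<^sub>m N) + (A * B + B)))"
    unfolding braiding_mult_left[OF M A] by (simp only: sqA A_BA)
  also have "?M + ((A + - 1\<^sub>m N) + (A * B + B)) = 2 \<cdot>\<^sub>m (A + B)"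
    unfolding anti
    by (rule eq_matI) (use A B AB in \<open>auto simp del: index_mult_mat(1)\<close>)
  finally show ?thesis
    by (intro eq_matI) (use A B in \<open>auto simp: field_simps\<close>)
qed

lemma braiding_braid:
  assumes A: "A \<in> carrier_mat N N" and B: "B \<in> carrier_mat N N"
    and sqA: "A * A = - 1\<^sub>m N" and sqB: "B * B = - 1\<^sub>m N" and anti: "B * A = - (A * B)"
  shows "braiding N A * (braiding N B * braiding N A) = braiding N B * (braiding N A * braiding N B)"
proof -
  have AB_anti: "A * B = - (B * A)" using A B by (simp add: anti)
  show ?thesis
    unfolding braiding_triple[OF A B sqA anti] braiding_triple[OF B A sqB AB_anti]
    using A B by (simp add: comm_add_mat)
qed

section \<open>The general linear group and conjugation of generated subgroups\<close>

lemma GL_mat_simps [simp]: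
  "x \<otimes>\<^bsub>GL_mat N\<^esub> y = x * y"
  "\<one>\<^bsub>GL_mat N\<^esub> = 1\<^sub>m N"
  by (simp_all add: GL_mat_def units_of_def ring_mat_simps)

lemma group_GL_mat: "group (GL_mat N)"
proof -
  interpret ring "ring_mat TYPE(complex) N ()" by (rule ring_mat)
  show ?thesis unfolding GL_mat_def by (rule units_group)
qed

lemma GL_mat_carrierD: "A \<in> carrier (GL_mat N) \<Longrightarrow> A \<in> carrier_mat N N"
  by (simp add: GL_mat_def units_of_def Units_def ring_mat_simps)

lemma GL_mat_carrierI:
  assumes "A \<in> carrier_mat N N" "B \<in> carrier_mat N N" "A * B = 1\<^sub>m N" "B * A = 1\<^sub>m N"
  shows "A \<in> carrier (GL_mat N)"
  using assms by (auto simp: GL_mat_def units_of_def Units_def ring_mat_simps)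

lemma GL_mat_carrierI_square:
  assumes "A \<in> carrier_mat N N" "A * A = - 1\<^sub>m N"
  shows "A \<in> carrier (GL_mat N)"
proof (rule GL_mat_carrierI)
  show "A * - A = 1\<^sub>m N" by (rule uminus_square(2)[OF assms])
  show "- A * A = 1\<^sub>m N"
    using assms(2) carrier_matD[OF assms(1)] by simp
qed (use assms in auto)

lemma braiding_in_GL_mat:
  assumes "A \<in> carrier_mat N N" "A * A = - 1\<^sub>m N"
  shows "braiding N A \<in> carrier (GL_mat N)"
proof (rule GL_mat_carrierI)
  have A: "- A \<in> carrier_mat N N" using assms by simp
  show "braiding N A * braiding N (- A) = 1\<^sub>m N" by (rule braiding_inverse[OF assms])
  show "braiding N (- A) * braiding N A = 1\<^sub>m N"
    using braiding_inverse[OF A uminus_square(1)[OF assms]] by simp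
qed (use assms in auto)

lemma uminus_one_mat_mult [simp]:
  fixes A :: "'a :: ring_1 mat"
  assumes "A \<in> carrier_mat N N"
  shows "- 1\<^sub>m N * A = - A" "A * - 1\<^sub>m N = - A"
  using carrier_matD[OF assms] by simp_all

lemma uminus_one_mat_neq: "N > 0 \<Longrightarrow> - 1\<^sub>m N \<noteq> (1\<^sub>m N :: complex mat)"
proof
  assume N: "N > 0" and "- 1\<^sub>m N = (1\<^sub>m N :: complex mat)"
  then have "(- 1\<^sub>m N) $$ (0, 0) = (1\<^sub>m N :: complex mat) $$ (0, 0)" by (simp only:)
  then show False using N by simp
qed

lemma uminus_one_in_GL_mat: "- 1\<^sub>m N \<in> carrier (GL_mat N)"
  by (rule GL_mat_carrierI[of _ _ "- 1\<^sub>m N"]) simp_all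

text \<open>Cancelling \<open>A\<close> would give \<open>- 1 = 1\<close>. This shows that
  anticommuting invertible matrices do not commute.\<close>

lemma GL_mat_neq_uminus:
  assumes "A \<in> carrier (GL_mat N)" "N > 0"
  shows "A \<noteq> - A"
proof
  interpret group "GL_mat N" by (rule group_GL_mat)
  assume *: "A = - A"
  have A: "A \<in> carrier_mat N N" by (rule GL_mat_carrierD[OF assms(1)])
  have "A \<otimes>\<^bsub>GL_mat N\<^esub> - 1\<^sub>m N = A \<otimes>\<^bsub>GL_mat N\<^esub> \<one>\<^bsub>GL_mat N\<^esub>"
    using * A carrier_matD[OF A] by simp
  then have "- 1\<^sub>m N = \<one>\<^bsub>GL_mat N\<^esub>"
    using Units_l_cancel[of A "- 1\<^sub>m N" "\<one>\<^bsub>GL_mat N\<^esub>"] assms(1) uminus_one_in_GL_mat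
    by (simp del: GL_mat_simps)
  then show False using uminus_one_mat_neq[OF assms(2)] by simp
qed

text \<open>The elements that \<open>g\<close> conjugates into the generated subgroup form a
  subgroup containing \<open>T\<close>. The condition on \<open>T\<close> is stated without
  inverses, in the form that matrix identities provide.\<close>

lemma (in group) generate_conj:
  assumes g: "g \<in> carrier G" and T: "T \<subseteq> carrier G"
    and conj: "\<And>t. t \<in> T \<Longrightarrow> \<exists>k\<in>generate G T. g \<otimes> t = k \<otimes> g"
    and k: "k \<in> generate G T"
  shows "g \<otimes> k \<otimes> inv g \<in> generate G T"
proof -
  interpret K: subgroup "generate G T" G by (rule generate_is_subgroup[OF T])
  let ?C = "{k \<in> carrier G. g \<otimes> k \<otimes> inv g \<in> generate G T}"
  have "subgroup ?C G"
  proof (rule subgroupI)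
    fix a assume a: "a \<in> ?C"
    then have "g \<otimes> inv a \<otimes> inv g = inv (g \<otimes> a \<otimes> inv g)"
      using g by (simp add: inv_mult_group m_assoc)
    then show "inv a \<in> ?C" using a by simp
  next
    fix a b assume a: "a \<in> ?C" and b: "b \<in> ?C"
    then have "g \<otimes> (a \<otimes> b) \<otimes> inv g = (g \<otimes> a \<otimes> inv g) \<otimes> (g \<otimes> b \<otimes> inv g)"
      using g by (simp add: m_assoc inv_solve_left[symmetric] flip: m_assoc[of "inv g" g])
    then show "a \<otimes> b \<in> ?C" using a b by simp
  qed (use g in auto)
  moreover have "T \<subseteq> ?C"
  proof
    fix t assume t: "t \<in> T"
    obtain k where k: "k \<in> generate G T" "g \<otimes> t = k \<otimes> g" using conj[OF t] by blast
    then have "g \<otimes> t \<otimes> inv g = k" using g K.subset by (auto simp: m_assoc)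
    then show "t \<in> ?C" using k t T by auto
  qed
  ultimately have "generate G T \<subseteq> ?C" by (intro generate_subgroup_incl)
  then show ?thesis using k by auto
qed

section \<open>The image of the pure braid group\<close>

definition S_group :: "nat \<Rightarrow> complex mat set" where
  "S_group n = generate (GL_mat (2 ^ n)) (insert (- 1\<^sub>m (2 ^ n)) (S_mat n ` {1..n-1}))"

lemma S_mat_in_GL: "i \<in> {1..n-1} \<Longrightarrow> S_mat n i \<in> carrier (GL_mat (2 ^ n))"
  by (intro GL_mat_carrierI_square S_mat_square) auto

lemma S_generators_in_GL:
  "insert (- 1\<^sub>m (2 ^ n)) (S_mat n ` {1..n-1}) \<subseteq> carrier (GL_mat (2 ^ n))"
  using S_mat_in_GL uminus_one_in_GL_mat by auto

lemma subgroup_S_group: "subgroup (S_group n) (GL_mat (2 ^ n))"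
  unfolding S_group_def by (intro group.generate_is_subgroup group_GL_mat S_generators_in_GL)

lemma S_mat_in_S_group: "i \<in> {1..n-1} \<Longrightarrow> S_mat n i \<in> S_group n"
  unfolding S_group_def by (auto intro: generate.incl)

lemma S_group_uminus: "A \<in> S_group n \<Longrightarrow> - A \<in> S_group n"
proof -
  interpret subgroup "S_group n" "GL_mat (2 ^ n)" by (rule subgroup_S_group)
  assume A: "A \<in> S_group n"
  have "- 1\<^sub>m (2 ^ n) \<in> S_group n" unfolding S_group_def by (auto intro: generate.incl)
  from m_closed[OF this A] show ?thesis
    using GL_mat_carrierD[OF mem_carrier[OF A]] by simp
qed

lemma S_group_mult: "\<lbrakk>A \<in> S_group n; B \<in> S_group n\<rbrakk> \<Longrightarrow> A * B \<in> S_group n"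
  using subgroup.m_closed[OF subgroup_S_group] by fastforce

lemma S_mat_commute_cases:
  assumes "i \<in> {1..n-1}" "j \<in> {1..n-1}"
  shows "S_mat n i * S_mat n j = S_mat n j * S_mat n i
    \<or> S_mat n i * S_mat n j = - (S_mat n j * S_mat n i)"
proof -
  consider "i = j" | "i + 2 \<le> j" | "j + 2 \<le> i" | "j = i + 1" | "i = j + 1" by linarith
  then show ?thesis
  proof cases
    case 4
    then show ?thesis using S_mat_near[of i n] assms by simp
  next
    case 5
    then show ?thesis using S_mat_near[of j n] assms by simp
  qed (use S_mat_far assms in auto)
qed

text \<open>The witness is \<open>t\<close> if \<open>B\<close> and \<open>t\<close> commute and
  \<open>B * t\<close> if they anticommute. Both signs of \<open>B\<close> are treated because
  \<open>- S_mat n j\<close> gives the inverse of the braiding of \<open>S_mat n j\<close>.\<close>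

lemma braiding_S_conj:
  assumes j: "j \<in> {1..n-1}" and B: "B = S_mat n j \<or> B = - S_mat n j"
    and t: "t \<in> insert (- 1\<^sub>m (2 ^ n)) (S_mat n ` {1..n-1})"
  shows "\<exists>k\<in>S_group n. braiding (2 ^ n) B * t = k * braiding (2 ^ n) B"
proof -
  let ?N = "2 ^ n"
  have c: "B \<in> carrier_mat ?N ?N" "S_mat n j \<in> carrier_mat ?N ?N" using B by auto
  have sq: "B * B = - 1\<^sub>m ?N"
    using B S_mat_square[OF j] uminus_square(1)[OF c(2)] by auto
  have BS: "B \<in> S_group n" using B S_mat_in_S_group[OF j] S_group_uminus by auto
  show ?thesis
  proof (cases "t = - 1\<^sub>m ?N")
    case True
    have "- 1\<^sub>m ?N \<in> S_group n" unfolding S_group_def by (auto intro: generate.incl)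
    then show ?thesis using True c by (intro bexI[of _ "- 1\<^sub>m ?N"]) simp_all
  next
    case False
    then obtain i where i: "t = S_mat n i" "i \<in> {1..n-1}" using t by auto
    have tc: "t \<in> carrier_mat ?N ?N" using i by simp
    have "B * t = t * B \<or> B * t = - (t * B)"
      using S_mat_commute_cases[OF j i(2)] B i c(2)[THEN carrier_matD(1)] c(2)[THEN carrier_matD(2)]
        tc[THEN carrier_matD(1)] tc[THEN carrier_matD(2)] by auto
    then have "braiding ?N B * t = t * braiding ?N B \<or> braiding ?N B * t = B * t * braiding ?N B"
      using braiding_conj_comm[OF tc c(1)] braiding_conj_anti[OF tc c(1) sq] by blast
    moreover have "t \<in> S_group n" using S_mat_in_S_group i by simp
    ultimately show ?thesis using S_group_mult[OF BS] by blast
  qed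
qed

text \<open>The Yang-Baxter relation for \<open>R\<close> becomes \<open>braiding_braid\<close> for
  two anticommuting square roots of \<open>- 1\<close>.\<close>

lemma braid_rep_presented_lift:
  "presented_lift_locale (GL_mat (2 ^ n)) {1..n-1} (braid_rels n) (braid_rep_gen n)"
proof -
  let ?N = "2 ^ n :: nat"
  interpret group "GL_mat ?N" by (rule group_GL_mat)
  have gen: "braid_rep_gen n i = braiding ?N (S_mat n i)" if "i \<in> {1..n-1}" for i
    using braid_rep_gen_eq[OF that] by (simp add: braiding_def)
  have c: "braiding ?N (S_mat n i) \<in> carrier_mat ?N ?N" for i by simp
  show ?thesis
  proof
    fix i assume "i \<in> {1..n-1}"
    then show "braid_rep_gen n i \<in> carrier (GL_mat ?N)"
      by (simp only: gen braiding_in_GL_mat S_mat_carrier S_mat_square)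
  next
    fix u v assume "(u, v) \<in> braid_rels n"
    then consider (far) i j where "u = [Pos i, Pos j]" "v = [Pos j, Pos i]"
          "i \<in> {1..n-1}" "j \<in> {1..n-1}" "\<bar>int i - int j\<bar> \<ge> 2"
      | (braid) i where "u = [Pos i, Pos (i+1), Pos i]" "v = [Pos (i+1), Pos i, Pos (i+1)]"
          "i \<in> {1..n-2}"
      unfolding braid_rels_def by auto
    then show "word_val (GL_mat ?N) (braid_rep_gen n) u = word_val (GL_mat ?N) (braid_rep_gen n) v"
    proof cases
      case far
      have "i + 2 \<le> j \<or> j + 2 \<le> i" using far by linarith
      then have "S_mat n i * S_mat n j = S_mat n j * S_mat n i"
        using S_mat_far[OF far(3,4)] S_mat_far[OF far(4,3)] by auto
      then have "braiding ?N (S_mat n i) * braiding ?N (S_mat n j)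
        = braiding ?N (S_mat n j) * braiding ?N (S_mat n i)"
        by (intro braiding_commute) simp_all
      then show ?thesis using far c[THEN carrier_matD(2)] by (simp add: gen)
    next
      case braid
      have i: "i \<in> {1..n-1}" "i + 1 \<in> {1..n-1}" using braid(3) by auto
      show ?thesis
        using braiding_braid[of "S_mat n i" ?N "S_mat n (i + 1)"] S_mat_square[OF i(1)]
          S_mat_square[OF i(2)] S_mat_near[OF i] i c[THEN carrier_matD(2)]
        by (simp add: braid gen)
    qed
  qed
qed

lemma braid_rep_group_hom: "group_hom (braid_group n) (GL_mat (2 ^ n)) (braid_rep n)"
  using presented_lift_locale.presented_lift_hom[OF braid_rep_presented_lift]
    group_braid_group group_GL_mat
  by (simp add: group_hom_def group_hom_axioms_def braid_rep_def braid_group_def)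

lemma braid_rep_braid_gen:
  "i \<in> {1..n-1} \<Longrightarrow> braid_rep n (braid_gen n i) = braiding (2 ^ n) (S_mat n i)"
  using presented_lift_locale.presented_lift_gen[OF braid_rep_presented_lift, of i n]
    braid_rep_gen_eq[of i n]
  by (simp add: braid_rep_def braid_gen_def braiding_def)

lemma braid_rep_square:
  assumes "i \<in> {1..n-1}"
  shows "braid_rep n (braid_gen n i \<otimes>\<^bsub>braid_group n\<^esub> braid_gen n i) = S_mat n i"
proof -
  interpret group_hom "braid_group n" "GL_mat (2 ^ n)" "braid_rep n" by (rule braid_rep_group_hom)
  show ?thesis
    using braiding_square[OF S_mat_carrier S_mat_square[OF assms]] assms
    by (simp add: braid_gen_closed braid_rep_braid_gen)
qed

text \<open>The matrices that conjugate \<open>S_group n\<close> into itself are closed under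
  products. As this is an inclusion rather than an equality, inverses of the generators are checked
  separately.\<close>

lemma braid_rep_normalizes:
  assumes "b \<in> carrier (braid_group n)" "k \<in> S_group n"
  shows "braid_rep n b \<otimes>\<^bsub>GL_mat (2 ^ n)\<^esub> k \<otimes>\<^bsub>GL_mat (2 ^ n)\<^esub> inv\<^bsub>GL_mat (2 ^ n)\<^esub> (braid_rep n b) \<in> S_group n"
proof -
  let ?N = "2 ^ n :: nat"
  let ?G = "GL_mat ?N"
  interpret group_hom "braid_group n" ?G "braid_rep n" by (rule braid_rep_group_hom)
  interpret K: subgroup "S_group n" ?G by (rule subgroup_S_group)
  let ?R = "\<lambda>i. braiding ?N (S_mat n i)"
  define D where "D = {g \<in> carrier ?G. \<forall>k\<in>S_group n. g \<otimes>\<^bsub>?G\<^esub> k \<otimes>\<^bsub>?G\<^esub> inv\<^bsub>?G\<^esub> g \<in> S_group n}"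
  have D_mult: "g \<otimes>\<^bsub>?G\<^esub> h \<in> D" if "g \<in> D" "h \<in> D" for g h
  proof -
    have "(g \<otimes>\<^bsub>?G\<^esub> h) \<otimes>\<^bsub>?G\<^esub> k \<otimes>\<^bsub>?G\<^esub> inv\<^bsub>?G\<^esub> (g \<otimes>\<^bsub>?G\<^esub> h) \<in> S_group n" if "k \<in> S_group n" for k
    proof -
      have "(g \<otimes>\<^bsub>?G\<^esub> h) \<otimes>\<^bsub>?G\<^esub> k \<otimes>\<^bsub>?G\<^esub> inv\<^bsub>?G\<^esub> (g \<otimes>\<^bsub>?G\<^esub> h)
        = g \<otimes>\<^bsub>?G\<^esub> (h \<otimes>\<^bsub>?G\<^esub> k \<otimes>\<^bsub>?G\<^esub> inv\<^bsub>?G\<^esub> h) \<otimes>\<^bsub>?G\<^esub> inv\<^bsub>?G\<^esub> g"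
        using \<open>g \<in> D\<close> \<open>h \<in> D\<close> K.mem_carrier[OF that]
        by (simp add: D_def H.inv_mult_group H.m_assoc del: GL_mat_simps)
      then show ?thesis using \<open>g \<in> D\<close> \<open>h \<in> D\<close> that by (simp add: D_def del: GL_mat_simps)
    qed
    then show ?thesis using that by (simp add: D_def del: GL_mat_simps)
  qed
  have braiding_D: "braiding ?N B \<in> D" if j: "j \<in> {1..n-1}" and B: "B = S_mat n j \<or> B = - S_mat n j" for j B
  proof -
    have "B \<in> carrier_mat ?N ?N" "B * B = - 1\<^sub>m ?N"
      using B S_mat_square[OF j] uminus_square(1)[OF S_mat_carrier] by auto
    then have g: "braiding ?N B \<in> carrier ?G" by (rule braiding_in_GL_mat)
    have "\<exists>k\<in>S_group n. braiding ?N B \<otimes>\<^bsub>?G\<^esub> t = k \<otimes>\<^bsub>?G\<^esub> braiding ?N B"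
      if "t \<in> insert (- 1\<^sub>m ?N) (S_mat n ` {1..n-1})" for t
      unfolding GL_mat_simps by (rule braiding_S_conj[OF j B that])
    note conj = H.generate_conj[OF g S_generators_in_GL this[unfolded S_group_def]]
    show ?thesis
      using g conj unfolding D_def S_group_def by blast
  qed
  \<comment> \<open>The inverse is again a braiding, so \<open>braiding_D\<close> applies to it with
    the opposite sign.\<close>
  have inv: "inv\<^bsub>?G\<^esub> (?R j) = braiding ?N (- S_mat n j)" if j: "j \<in> {1..n-1}" for j
  proof (rule H.inv_equality)
    have "- S_mat n j \<in> carrier_mat ?N ?N" by simp
    then show "braiding ?N (- S_mat n j) \<otimes>\<^bsub>?G\<^esub> ?R j = \<one>\<^bsub>?G\<^esub>"
      using braiding_inverse[of "- S_mat n j" ?N] uminus_square(1)[OF S_mat_carrier S_mat_square[OF j]]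
      by simp
  qed (use braiding_D[OF j] in \<open>auto simp: D_def\<close>)
  have one: "\<one>\<^bsub>?G\<^esub> \<in> D" using K.mem_carrier by (auto simp: D_def simp del: GL_mat_simps)
  have "braid_rep n ` carrier (braid_group n) = generate ?G (braid_rep n ` braid_gen n ` {1..n-1})"
    using braid_gen_closed by (intro hom_image_generated braid_group_generated) auto
  also have "braid_rep n ` braid_gen n ` {1..n-1} = ?R ` {1..n-1}"
    unfolding image_image by (intro image_cong refl braid_rep_braid_gen)
  finally have "braid_rep n b \<in> generate ?G (?R ` {1..n-1})" using assms(1) by blast
  then have "\<one>\<^bsub>?G\<^esub> \<otimes>\<^bsub>?G\<^esub> braid_rep n b \<in> D"
  proof (rule generate_mult_closed[OF H.is_group _ _ _ _ _ one])
    fix d t assume "d \<in> D" and "t \<in> ?R ` {1..n-1}"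
    then obtain j where t: "t = ?R j" "j \<in> {1..n-1}" and "d \<in> D" by auto
    show "d \<otimes>\<^bsub>?G\<^esub> t \<in> D"
      using D_mult[OF \<open>d \<in> D\<close> braiding_D[OF t(2)]] t(1) by blast
    show "d \<otimes>\<^bsub>?G\<^esub> inv\<^bsub>?G\<^esub> t \<in> D"
      using D_mult[OF \<open>d \<in> D\<close> braiding_D[OF t(2)]] t(1) inv[OF t(2)] by simp
  next
    show "?R ` {1..n-1} \<subseteq> carrier ?G" using braiding_D by (auto simp: D_def)
  qed (auto simp: D_def)
  then have "braid_rep n b \<in> D" using assms(1) by (simp del: GL_mat_simps)
  then show ?thesis using assms(2) by (simp add: D_def del: GL_mat_simps)
qed

text \<open>One inclusion holds because the preimage of \<open>S_group n\<close> is normal and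
  contains the squares of the generators. For the other, the image is a subgroup containing all
  generators of \<open>S_group n\<close>.\<close>

lemma braid_rep_pure_braid:
  assumes "n \<ge> 2"
  shows "braid_rep n ` pure_braid n = S_group n"
proof
  let ?N = "2 ^ n :: nat"
  let ?G = "GL_mat ?N" and ?B = "braid_group n"
  interpret group_hom ?B ?G "braid_rep n" by (rule braid_rep_group_hom)
  interpret K: subgroup "S_group n" ?G by (rule subgroup_S_group)
  define M where "M = {b \<in> carrier ?B. braid_rep n b \<in> S_group n}"
  have "M \<lhd> ?B"
    unfolding G.normal_inv_iff
  proof (intro conjI ballI)
    show "subgroup M ?B"
      by (rule G.subgroupI) (auto simp: M_def simp del: GL_mat_simps intro: G.one_closed)
    fix b m assume "b \<in> carrier ?B" "m \<in> M"
    then show "b \<otimes>\<^bsub>?B\<^esub> m \<otimes>\<^bsub>?B\<^esub> inv\<^bsub>?B\<^esub> b \<in> M"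
      using braid_rep_normalizes[of b n "braid_rep n m"]
      by (simp add: M_def del: GL_mat_simps)
  qed
  then have "pure_braid n \<subseteq> M"
    by (rule pure_braid_subset_normal)
       (simp add: M_def braid_gen_closed braid_rep_square S_mat_in_S_group del: hom_mult)
  then show "braid_rep n ` pure_braid n \<subseteq> S_group n" by (auto simp: M_def)
  have sub: "subgroup (braid_rep n ` pure_braid n) ?G"
    by (rule subgroup_img_is_subgroup[OF subgroup_pure_braid])
  have S: "S_mat n i \<in> braid_rep n ` pure_braid n" if "i \<in> {1..n-1}" for i
    using braid_rep_square[OF that] braid_gen_square_pure[OF that] by (metis imageI)
  \<comment> \<open>From \<open>n \<ge> 2\<close> there is at least one generator, and the square of
    its \<open>S_mat\<close> supplies \<open>- 1\<close>.\<close>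
  have "1 \<in> {1..n-1}" using assms by simp
  then have "S_mat n 1 \<otimes>\<^bsub>?G\<^esub> S_mat n 1 \<in> braid_rep n ` pure_braid n"
    by (intro subgroup.m_closed[OF sub] S)
  then have "- 1\<^sub>m ?N \<in> braid_rep n ` pure_braid n"
    using S_mat_square[OF \<open>1 \<in> {1..n-1}\<close>] by simp
  then show "S_group n \<subseteq> braid_rep n ` pure_braid n"
    unfolding S_group_def using S by (intro H.generate_subgroup_incl sub) auto
qed

section \<open>The isomorphism\<close>

fun E_rep_gen :: "nat \<Rightarrow> E_gen \<Rightarrow> complex mat" where
  "E_rep_gen n MinusOne = - 1\<^sub>m (2 ^ n)"
| "E_rep_gen n (Xgen i) = S_mat n i"

lemma E_rep_presented_lift:
  "presented_lift_locale (GL_mat (2 ^ n)) (insert MinusOne (Xgen ` {1..n-1}))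
     (E_rels (n - 1) (- 1)) (E_rep_gen n)"
proof -
  let ?N = "2 ^ n :: nat"
  interpret group "GL_mat ?N" by (rule group_GL_mat)
  have c [simp]: "dim_row (S_mat n i) = ?N" "dim_col (S_mat n i) = ?N" for i
    using carrier_matD[OF S_mat_carrier] by auto
  show ?thesis
  proof
    fix x assume "x \<in> insert MinusOne (Xgen ` {1..n-1})"
    then show "E_rep_gen n x \<in> carrier (GL_mat ?N)"
      using S_mat_in_GL uminus_one_in_GL_mat by auto
  next
    fix u v assume "(u, v) \<in> E_rels (n - 1) (- 1)"
    then consider (sq1) "u = [Pos MinusOne, Pos MinusOne]" "v = []"
      | (central) i where "u = [Pos MinusOne, Pos (Xgen i)]" "v = [Pos (Xgen i), Pos MinusOne]"
      | (sq) i where "u = [Pos (Xgen i), Pos (Xgen i)]" "v = [Pos MinusOne]" "i \<in> {1..n-1}"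
      | (far) i j where "u = [Pos (Xgen i), Pos (Xgen j)]" "v = [Pos (Xgen j), Pos (Xgen i)]"
          "i \<in> {1..n-1}" "j \<in> {1..n-1}" "\<bar>int i - int j\<bar> \<ge> 2"
      | (near) i where "u = [Pos (Xgen (i+1)), Pos (Xgen i)]"
          "v = [Pos MinusOne, Pos (Xgen i), Pos (Xgen (i+1))]" "i \<in> {1..n-1-1}"
      unfolding E_rels_def sign_word_def by auto
    then show "word_val (GL_mat ?N) (E_rep_gen n) u = word_val (GL_mat ?N) (E_rep_gen n) v"
    proof cases
      case far
      have "i + 2 \<le> j \<or> j + 2 \<le> i" using far by linarith
      then have "S_mat n i * S_mat n j = S_mat n j * S_mat n i"
        using S_mat_far[OF far(3,4)] S_mat_far[OF far(4,3)] by auto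
      then show ?thesis using far by simp
    next
      case near
      then have "i \<in> {1..n-1}" "i + 1 \<in> {1..n-1}" by auto
      then show ?thesis using S_mat_near[of i n] near by simp
    qed (simp_all add: S_mat_square)
  qed
qed

section \<open>The relations in the abstract group and the isomorphism\<close>

definition E_elt :: "nat \<Rightarrow> E_gen \<Rightarrow> E_gen letter list set" where
  "E_elt m x = pres_class (insert MinusOne (Xgen ` {1..m})) (E_rels m (- 1)) [Pos x]"

lemma E_elt_closed: "x \<in> insert MinusOne (Xgen ` {1..m}) \<Longrightarrow> E_elt m x \<in> carrier (E_group m (- 1))"
  by (auto simp: E_elt_def E_group_def carrier_presented_group)

lemma E_group_generated:
  "carrier (E_group m (- 1)) = generate (E_group m (- 1)) (E_elt m ` insert MinusOne (Xgen ` {1..m}))"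
  unfolding E_group_def E_elt_def by (rule presented_group_generated)

lemma E_minus_square: "E_elt m MinusOne \<otimes>\<^bsub>E_group m (- 1)\<^esub> E_elt m MinusOne = \<one>\<^bsub>E_group m (- 1)\<^esub>"
proof -
  have "([Pos MinusOne, Pos MinusOne], []) \<in> E_rels m (- 1)" by (simp add: E_rels_def)
  then show ?thesis
    by (simp add: E_elt_def E_group_def mult_presented_group one_presented_group
        pres_class_eq_iff pres_rel)
qed

lemma E_x_square:
  assumes "i \<in> {1..m}"
  shows "E_elt m (Xgen i) \<otimes>\<^bsub>E_group m (- 1)\<^esub> E_elt m (Xgen i) = E_elt m MinusOne"
proof -
  have "([Pos (Xgen i), Pos (Xgen i)], [Pos MinusOne]) \<in> E_rels m (- 1)"
    using assms by (simp add: E_rels_def sign_word_def)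
  then show ?thesis
    using assms by (simp add: E_elt_def E_group_def mult_presented_group pres_class_eq_iff pres_rel)
qed

lemma E_minus_central:
  assumes "i \<in> {1..m}"
  shows "E_elt m (Xgen i) \<otimes>\<^bsub>E_group m (- 1)\<^esub> E_elt m MinusOne
    = E_elt m MinusOne \<otimes>\<^bsub>E_group m (- 1)\<^esub> E_elt m (Xgen i)"
proof -
  have "([Pos MinusOne, Pos (Xgen i)], [Pos (Xgen i), Pos MinusOne]) \<in> E_rels m (- 1)"
    using assms by (simp add: E_rels_def)
  then show ?thesis
    using assms by (simp add: E_elt_def E_group_def mult_presented_group pres_class_eq_iff
        pres_sym[OF pres_rel])
qed

lemma E_x_x:
  assumes "i \<in> {1..m}" "j \<in> {1..m}" "j < i"
  shows "E_elt m (Xgen i) \<otimes>\<^bsub>E_group m (- 1)\<^esub> E_elt m (Xgen j)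
      = E_elt m (Xgen j) \<otimes>\<^bsub>E_group m (- 1)\<^esub> E_elt m (Xgen i)
    \<or> E_elt m (Xgen i) \<otimes>\<^bsub>E_group m (- 1)\<^esub> E_elt m (Xgen j)
      = E_elt m MinusOne \<otimes>\<^bsub>E_group m (- 1)\<^esub> (E_elt m (Xgen j) \<otimes>\<^bsub>E_group m (- 1)\<^esub> E_elt m (Xgen i))"
proof (cases "i = j + 1")
  case True
  then have "j \<in> {1..m-1}" using assms by auto
  then have "([Pos (Xgen i), Pos (Xgen j)], [Pos MinusOne, Pos (Xgen j), Pos (Xgen i)]) \<in> E_rels m (- 1)"
    unfolding True E_rels_def by blast
  then show ?thesis
    using assms by (simp add: E_elt_def E_group_def mult_presented_group pres_class_eq_iff pres_rel)
next
  case False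
  then have "\<bar>int i - int j\<bar> \<ge> 2" using assms by linarith
  then have "([Pos (Xgen i), Pos (Xgen j)], [Pos (Xgen j), Pos (Xgen i)]) \<in> E_rels m (- 1)"
    using assms(1,2) unfolding E_rels_def by blast
  then show ?thesis
    using assms by (simp add: E_elt_def E_group_def mult_presented_group pres_class_eq_iff pres_rel)
qed

text \<open>Generators go to generators, which gives surjectivity; injectivity is
  \<open>E_like_generators\<close> with the sign matrices \<open>D_mat n\<close> as detecting
  elements.\<close>

lemma S_group_iso_E_group:
  "presented_lift (GL_mat (2 ^ n)) (E_rep_gen n)
     \<in> iso (E_group (n - 1) (- 1)) ((GL_mat (2 ^ n)) \<lparr>carrier := S_group n\<rparr>)"
proof -
  let ?N = "2 ^ n :: nat" and ?X = "insert MinusOne (Xgen ` {1..n-1})"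
  let ?G = "GL_mat ?N" and ?E = "E_group (n - 1) (- 1)" and ?c = "E_elt (n - 1)"
  define \<epsilon> where "\<epsilon> = presented_lift ?G (E_rep_gen n)"
  interpret L: presented_lift_locale ?G ?X "E_rels (n - 1) (- 1)" "E_rep_gen n"
    by (rule E_rep_presented_lift)
  interpret E: group ?E unfolding E_group_def by (rule group_presented_group)
  have \<epsilon>_gen: "\<epsilon> (?c x) = E_rep_gen n x" if "x \<in> ?X" for x
    unfolding \<epsilon>_def E_elt_def by (rule L.presented_lift_gen[OF that])
  have \<epsilon>_z: "\<epsilon> (?c MinusOne) = - 1\<^sub>m ?N" using \<epsilon>_gen by simp
  have \<epsilon>_x: "\<epsilon> (?c (Xgen i)) = S_mat n i" if "i \<in> {1..n-1}" for i
    using \<epsilon>_gen[of "Xgen i"] that by simp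
  interpret \<epsilon>: group_hom ?E ?G \<epsilon>
    by unfold_locales (use L.presented_lift_hom in \<open>simp add: \<epsilon>_def E_group_def\<close>)
  have D: "D_mat n i \<in> carrier ?G" for i
    using D_mat_square by (intro GL_mat_carrierI[of _ _ "D_mat n i"]) auto
  interpret C: E_like_generators ?E ?G \<epsilon> "?c MinusOne" "\<lambda>i. ?c (Xgen i)" "D_mat n" "n - 1"
  proof
    show "?c MinusOne \<in> carrier ?E" by (rule E_elt_closed) simp
    show "?c MinusOne \<otimes>\<^bsub>?E\<^esub> ?c MinusOne = \<one>\<^bsub>?E\<^esub>" by (rule E_minus_square)
    show "\<epsilon> (?c MinusOne) \<noteq> \<one>\<^bsub>?G\<^esub>"
      unfolding \<epsilon>_z using uminus_one_mat_neq[of ?N] by simp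
  next
    fix i assume i: "i \<in> {1..n-1}"
    show "?c (Xgen i) \<in> carrier ?E" using i by (intro E_elt_closed) blast
    show "?c (Xgen i) \<otimes>\<^bsub>?E\<^esub> ?c (Xgen i) = ?c MinusOne" by (rule E_x_square[OF i])
    show "?c (Xgen i) \<otimes>\<^bsub>?E\<^esub> ?c MinusOne = ?c MinusOne \<otimes>\<^bsub>?E\<^esub> ?c (Xgen i)"
      by (rule E_minus_central[OF i])
    show "D_mat n i \<in> carrier ?G" by (rule D)
    show "D_mat n i \<otimes>\<^bsub>?G\<^esub> \<epsilon> (?c MinusOne) = \<epsilon> (?c MinusOne) \<otimes>\<^bsub>?G\<^esub> D_mat n i"
      unfolding \<epsilon>_z by simp
    \<comment> \<open>The two orders of multiplication differ by a sign, and an invertible matrix is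
      never its own negative.\<close>
    have "D_mat n i * S_mat n i \<in> carrier ?G"
      using L.m_closed[OF D S_mat_in_GL[OF i]] by simp
    from GL_mat_neq_uminus[OF this]
    show "D_mat n i \<otimes>\<^bsub>?G\<^esub> \<epsilon> (?c (Xgen i)) \<noteq> \<epsilon> (?c (Xgen i)) \<otimes>\<^bsub>?G\<^esub> D_mat n i"
      unfolding \<epsilon>_x[OF i] using D_mat_S_mat_eq[OF i] by auto
  next
    fix i j assume i: "i \<in> {1..n-1}" and j: "j \<in> {1..n-1}" and "j < i"
    show "D_mat n i \<otimes>\<^bsub>?G\<^esub> \<epsilon> (?c (Xgen j)) = \<epsilon> (?c (Xgen j)) \<otimes>\<^bsub>?G\<^esub> D_mat n i"
      unfolding \<epsilon>_x[OF j] using D_mat_S_mat_less[OF j \<open>j < i\<close>] by simp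
    show "?c (Xgen i) \<otimes>\<^bsub>?E\<^esub> ?c (Xgen j) = ?c (Xgen j) \<otimes>\<^bsub>?E\<^esub> ?c (Xgen i)
      \<or> ?c (Xgen i) \<otimes>\<^bsub>?E\<^esub> ?c (Xgen j) = ?c MinusOne \<otimes>\<^bsub>?E\<^esub> (?c (Xgen j) \<otimes>\<^bsub>?E\<^esub> ?c (Xgen i))"
      by (rule E_x_x[OF i j \<open>j < i\<close>])
  qed
  have "\<epsilon> ` carrier ?E = generate ?G (\<epsilon> ` ?c ` ?X)"
    using E_elt_closed[of _ "n - 1"] by (intro \<epsilon>.hom_image_generated E_group_generated) blast
  also have "\<epsilon> ` ?c ` ?X = E_rep_gen n ` ?X"
    unfolding image_image by (intro image_cong refl \<epsilon>_gen)
  also have "generate ?G \<dots> = S_group n"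
    by (simp add: S_group_def image_image)
  finally have img: "\<epsilon> ` carrier ?E = S_group n" .
  have gens: "?c ` ?X = insert (?c MinusOne) ((\<lambda>i. ?c (Xgen i)) ` {1..n-1})"
    by (simp add: image_image)
  have "g = \<one>\<^bsub>?E\<^esub>" if "g \<in> carrier ?E" "\<epsilon> g = \<one>\<^bsub>?G\<^esub>" for g
  proof (rule C.\<phi>_injective)
    show "g \<in> C.V (n - 1)"
      using that(1) E_group_generated[of "n - 1"] unfolding C.V_def gens by blast
  qed (use that in auto)
  then have "inj_on \<epsilon> (carrier ?E)" unfolding \<epsilon>.inj_on_one_iff by blast
  moreover have "\<epsilon> \<in> hom ?E (?G \<lparr>carrier := S_group n\<rparr>)"
    using \<epsilon>.homh img unfolding hom_def by auto
  ultimately show ?thesis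
    using img unfolding \<epsilon>_def iso_iff by simp
qed

theorem theorem4p1:
  fixes n :: nat
  assumes "n \<ge> 2"
  shows "H_group n \<cong> E_group (n - 1) (- 1)"
proof -
  \<comment> \<open>The isomorphism is built out of the abstract group, and reversing its direction
    uses that its source is a group.\<close>
  have "group (E_group (n - 1) (- 1))"
    by (simp add: E_group_def group_presented_group)
  moreover have "E_group (n - 1) (- 1) \<cong> H_group n"
    using S_group_iso_E_group[of n] braid_rep_pure_braid[OF assms]
    by (auto simp: is_iso_def H_group_def)
  ultimately show ?thesis by (rule group.iso_sym)
qed

end
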